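(* Let $\sigma$ be a module ordering on $\mathbb{T}^n\langle e_1,\dots,e_r\rangle$ and let $\overline{\sigma}$ be its extension by $W$. Let $v_1,\dots,v_s$ be non-zero vectors in $F$, let $M$ be the submodule of $F$ generated by the set $\{v_1,\dots,v_s\}$, and let $\{V_1,V_2,\dots,V_t\}$ be the output of any Weak Self-Saturating Buchberger's Algorithm (with respect to $\overline{\sigma}$) applied to the set $\{v_1^{\rm hom},v_2^{\rm hom},\dots,v_s^{\rm hom}\}$. Then the set $\{V_1^{\rm deh},\dots,V_t^{\rm deh}\}$ is a $\sigma$-Gröbner basis of $M$.
   Context: Setting. $K$ is a field, $P=K[x_1,\dots,x_n]$, $W\in\mathrm{Mat}_{m,n}(\mathbb{Z})$ is a matrix of rank $m\ge 1$, and $\overline{P}=K[y_1,\dots,y_m,x_1,\dots,x_n]$ is graded by $\overline{W}=(I_m\mid W)$, i.e. $\deg_{\overline W}(y_i)$ is the $i$-th standard basis vector of $\mathbb{Z}^m$ and $\deg_{\overline W}(x_j)$ is the $j$-th column of $W$. $\mathbb{T}^n$ and $\mathbb{T}^{m+n}$ are the monoids of power products of $P$ and $\overline{P}$. $F=P^r$ has canonical basis $e_1,\dots,e_r$; $\delta_1,\dots,\delta_r\in\mathbb{Z}^m$ are fixed and $\overline{F}=\bigoplus_{i=1}^r\overline{P}(-\delta_i)$, so $\deg(te_i)=\deg(t)+\delta_i$. The sets of terms $te_i$ of $F$ and of $\overline F$ are denoted $\mathbb{T}^n\langle e_1,\dots,e_r\rangle$ and $\mathbb{T}^{m+n}\langle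 e_1,\dots,e_r\rangle$. $\mathbb{Z}^m$ is ordered lexicographically. Orderings. A module ordering on a set of terms is a total ordering compatible with multiplication by power products and compatible with a monoid ordering $\tau$ on power products ($t_1>_\tau t_2$ implies $t_1e_i>t_2e_i$). The extension $\overline{\sigma}$ of $\sigma$ by $W$ is the ordering on $\mathbb{T}^{m+n}\langle e_1,\dots,e_r\rangle$ given by: $t_1e_i>_{\overline\sigma}t_2e_j$ iff $\deg_{\overline W}(t_1e_i)>\deg_{\overline W}(t_2e_j)$, or these degrees are equal and $t_1^{\rm deh}e_i>_\sigma t_2^{\rm deh}e_j$. LT denotes the leading term. A $\sigma$-Gröbner basis of a module is a set of non-zero elements of it whose leading terms generate the module generated by all leading terms of its non-zero elements. Homogenization. For $V\in\overline F$, $V^{\rm deh}\in F$ is obtained by setting $y_1=\dots=y_m=1$ (likewise for power products). For $0\ne v=\sum_j c_jt_je_{i_j}\in F$ (distinct terms, $c_j\neq0$), let $\mu\in\mathbb{Z}^m$ be the componentwise maximum of the $\deg_W(t_je_{i_j})$; then $v^{\rm hom}=\sum_j c_j\,y^{\mu-\deg_W(t_je_{i_j})}t_je_{i_j}\in\overline F$, and $0^{\rm hom}=0$. For homogeneous $U\in\overline F$, the saturation of $U$ is $U^{\rm sat}=(U^{\rm deh})^{\rm hom}$. Algorithms. If $U,V$ have leading monomials $c_Ut_Ue_i$, $c_Vt_Ve_i$, then $S(U,V)=\frac{\mathrm{lcm}(t_U,t_V)}{c_Ut_U}U-\frac{\mathrm{lcm}(t_U,t_V)}{c_Vt_V}V$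 (pairs whose leading terms lie in different components are ignored). A remainder of $Q$ by $\mathcal G$ is an output of the division algorithm (repeatedly subtracting multiples $c\,t\,V$, $V\in\mathcal G$, $c\in K$, $t$ a power product, cancelling a term of the current vector), ending with a vector that is zero or has leading term not divisible by $\mathrm{LT}(V)$ for any $V\in\mathcal G$. A weak saturating remainder of a homogeneous $Q$ by a tuple $\mathcal G$ of homogeneous vectors is obtained in the same way, except that at each step the current vector may be replaced by any homogeneous vector with the same saturation. Buchberger's Algorithm applied to $u_1,\dots,u_s$: (1) set Pairs $=\emptyset$, Gens $=(u_1,\dots,u_s)$, $\mathcal G=\emptyset$. (2) While Gens $\neq\emptyset$ or Pairs $\neq\emptyset$: (2a) choose $Q\in$ Gens and remove it from Gens, or choose $(V_i,V_j)\in$ Pairs, remove it from Pairs and let $Q=S(V_i,V_j)$; (2b) compute a remainder $V$ of $Q$ by $\mathcal G$; (2c) if $V\ne0$, add $V$ to $\mathcal G$ and the pairs of $V$ with all previous elements of $\mathcal G$ to Pairs. (3) Return $\mathcal G$. All choices are arbitrary. A Weak Self-Saturating Buchberger's Algorithm is this procedure on homogeneous vectors of $\overline F$ with respect to $\overline\sigma$, where in (2b) $V$ is instead a weak saturating remainder of $Q$ by $\mathcal G$. *)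

theory Defs
  imports "HOL-Analysis.Analysis" "HOL-Library.Poly_Mapping" "HOL-Library.Multiset"
begin

text \<open>
  A power product in the indeterminates indexed by \<open>'v\<close> is a map from \<open>'v\<close> to exponents (so the
  monoid of power products is written additively), a polynomial is a map from power products to
  coefficients with the convolution product, and an element of the free module is a vector of
  polynomials. The term \<open>t e\<^sub>i\<close> is the pair \<open>(t, i)\<close>. The indeterminates of the extended ring are
  indexed by \<open>'m + 'n\<close>: \<open>Inl k\<close> stands for \<open>y\<^sub>k\<close> and \<open>Inr j\<close> for \<open>x\<^sub>j\<close>.
\<close>

type_synonym 'v pp = "'v \<Rightarrow>\<^sub>0 nat"
type_synonym ('v, 'r) mterm = "'v pp \<times> 'r"
type_synonym ('v, 'k) mpol = "'v pp \<Rightarrow>\<^sub>0 'k"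
type_synonym ('v, 'r, 'k) fvec = "('v, 'k) mpol ^ 'r"

definition mk_pp :: "('v::finite \<Rightarrow> nat) \<Rightarrow> 'v pp"
  where "mk_pp f = Abs_poly_mapping f"

lemma lookup_mk_pp [simp]: "Poly_Mapping.lookup (mk_pp f) = f"
  by (simp add: mk_pp_def)

definition pp_lcm :: "'v::finite pp \<Rightarrow> 'v pp \<Rightarrow> 'v pp"
  where "pp_lcm s t = mk_pp (\<lambda>x. max (Poly_Mapping.lookup s x) (Poly_Mapping.lookup t x))"

definition term_times :: "'v pp \<Rightarrow> ('v, 'r) mterm \<Rightarrow> ('v, 'r) mterm"
  where "term_times s t = (s + fst t, snd t)"

definition mterms :: "('v, 'r::finite, 'k::zero) fvec \<Rightarrow> ('v, 'r) mterm set"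
  where "mterms v = {(t, i). t \<in> Poly_Mapping.keys (v $ i)}"

definition mcoeff :: "('v, 'r::finite, 'k::zero) fvec \<Rightarrow> ('v, 'r) mterm \<Rightarrow> 'k"
  where "mcoeff v t = Poly_Mapping.lookup (v $ snd t) (fst t)"

definition term_vec :: "('v, 'r) mterm \<Rightarrow> ('v, 'r::finite, 'k::field) fvec"
  where "term_vec t = axis (snd t) (Poly_Mapping.single (fst t) 1)"

lemma module_vec: "module ((*s) :: 'a::comm_ring_1 \<Rightarrow> 'a ^ 'r \<Rightarrow> 'a ^ 'r)"
  by unfold_locales (simp_all add: vector_add_ldistrib vector_sadd_rdistrib)

text \<open>
  Consequently \<open>module.span (*s) S\<close> is the submodule generated by \<open>S\<close>.
\<close>

text \<open>
  Orderings are given by their strict part: \<open>(u, t) \<in> \<sigma>\<close> means \<open>t >\<^sub>\<sigma> u\<close>. They are not required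
  to be well-founded.
\<close>

definition monoid_ordering :: "'v pp rel \<Rightarrow> bool"
  where "monoid_ordering \<tau> \<longleftrightarrow> strict_linear_order \<tau> \<and>
    (\<forall>u t s. (u, t) \<in> \<tau> \<longrightarrow> (s + u, s + t) \<in> \<tau>)"

definition module_ordering :: "('v, 'r) mterm rel \<Rightarrow> bool"
  where "module_ordering \<sigma> \<longleftrightarrow> strict_linear_order \<sigma> \<and>
    (\<forall>u t s. (u, t) \<in> \<sigma> \<longrightarrow> (term_times s u, term_times s t) \<in> \<sigma>) \<and>
    (\<exists>\<tau>. monoid_ordering \<tau> \<and> (\<forall>u t i. (u, t) \<in> \<tau> \<longrightarrow> ((u, i), (t, i)) \<in> \<sigma>))"

definition lex_less :: "int ^ 'm::{finite, linorder} \<Rightarrow> int ^ 'm::{finite, linorder} \<Rightarrow> bool"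
  where "lex_less a b \<longleftrightarrow> (\<exists>k. a $ k < b $ k \<and> (\<forall>l<k. a $ l = b $ l))"

definition lead_term :: "('v, 'r) mterm rel \<Rightarrow> ('v, 'r::finite, 'k::zero) fvec \<Rightarrow> ('v, 'r) mterm"
  where "lead_term \<sigma> v = (THE t. t \<in> mterms v \<and> (\<forall>u \<in> mterms v. u \<noteq> t \<longrightarrow> (u, t) \<in> \<sigma>))"

definition lead_coeff :: "('v, 'r) mterm rel \<Rightarrow> ('v, 'r::finite, 'k::zero) fvec \<Rightarrow> 'k"
  where "lead_coeff \<sigma> v = mcoeff v (lead_term \<sigma> v)"

definition groebner_basis ::
  "('v, 'r) mterm rel \<Rightarrow> ('v, 'r::finite, 'k::field) fvec set \<Rightarrow> ('v, 'r, 'k) fvec set \<Rightarrow> bool"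
  where "groebner_basis \<sigma> M G \<longleftrightarrow> G \<subseteq> M - {0} \<and>
    module.span (*s) ((\<lambda>v. term_vec (lead_term \<sigma> v) :: ('v, 'r, 'k) fvec) ` G) =
    module.span (*s) ((\<lambda>v. term_vec (lead_term \<sigma> v)) ` (M - {0}))"

definition pp_deg :: "int ^ 'v ^ 'm \<Rightarrow> 'v::finite pp \<Rightarrow> int ^ 'm::finite"
  where "pp_deg A t = A *v (\<chi> x. int (Poly_Mapping.lookup t x))"

definition term_deg ::
  "int ^ 'v ^ 'm \<Rightarrow> ('r \<Rightarrow> int ^ 'm) \<Rightarrow> ('v::finite, 'r) mterm \<Rightarrow> int ^ 'm::finite"
  where "term_deg A \<delta> t = pp_deg A (fst t) + \<delta> (snd t)"

definition Wbar :: "int ^ 'n ^ 'm \<Rightarrow> int ^ ('m::finite + 'n::finite) ^ 'm"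
  where "Wbar W = (\<chi> k x. case x of Inl l \<Rightarrow> mat 1 $ k $ l | Inr j \<Rightarrow> W $ k $ j)"

definition homogeneous ::
  "int ^ 'n ^ 'm \<Rightarrow> ('r \<Rightarrow> int ^ 'm) \<Rightarrow> ('m::finite + 'n::finite, 'r::finite, 'k::zero) fvec \<Rightarrow> bool"
  where "homogeneous W \<delta> U \<longleftrightarrow> (\<exists>d. \<forall>t \<in> mterms U. term_deg (Wbar W) \<delta> t = d)"

text \<open>Composing with \<open>Inr\<close> drops the exponents of the \<open>y\<^sub>k\<close>, i.e. sets all \<open>y\<^sub>k\<close> to 1.\<close>

definition deh_pp :: "('m + 'n) pp \<Rightarrow> 'n pp"
  where "deh_pp t = Poly_Mapping.map_key Inr t"

lemma lookup_deh_pp [simp]: "Poly_Mapping.lookup (deh_pp t) j = Poly_Mapping.lookup t (Inr j)"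
  by (simp add: deh_pp_def map_key.rep_eq)

definition deh_term :: "('m + 'n, 'r) mterm \<Rightarrow> ('n, 'r) mterm"
  where "deh_term t = (deh_pp (fst t), snd t)"

definition deh :: "('m + 'n, 'r::finite, 'k::comm_monoid_add) fvec \<Rightarrow> ('n, 'r, 'k) fvec"
  where "deh V = (\<chi> i. \<Sum>t \<in> Poly_Mapping.keys (V $ i).
    Poly_Mapping.single (deh_pp t) (Poly_Mapping.lookup (V $ i) t))"

text \<open>
  The componentwise maximum of the degrees of the terms of \<open>v\<close>; irrelevant for \<open>v = 0\<close>, where the
  sum in \<open>hom\<close> is empty and \<open>hom W \<delta> 0 = 0\<close>.
\<close>

definition top_deg ::
  "int ^ 'n ^ 'm \<Rightarrow> ('r \<Rightarrow> int ^ 'm) \<Rightarrow> ('n::finite, 'r::finite, 'k::zero) fvec \<Rightarrow> int ^ 'm::finite"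
  where "top_deg W \<delta> v = (\<chi> k. Max ((\<lambda>t. term_deg W \<delta> t $ k) ` mterms v))"

text \<open>The power product \<open>y\<^bsup>a\<^esup> t\<close>; it is only used for \<open>a\<close> with non-negative components.\<close>

definition y_times :: "int ^ 'm \<Rightarrow> 'n pp \<Rightarrow> ('m::finite + 'n::finite) pp"
  where "y_times a t = mk_pp (case_sum (\<lambda>k. nat (a $ k)) (Poly_Mapping.lookup t))"

definition hom ::
  "int ^ 'n ^ 'm \<Rightarrow> ('r \<Rightarrow> int ^ 'm) \<Rightarrow> ('n::finite, 'r::finite, 'k::comm_monoid_add) fvec \<Rightarrow>
   ('m::finite + 'n, 'r, 'k) fvec"
  where "hom W \<delta> v = (\<chi> i. \<Sum>t \<in> Poly_Mapping.keys (v $ i).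
    Poly_Mapping.single (y_times (top_deg W \<delta> v - term_deg W \<delta> (t, i)) t)
      (Poly_Mapping.lookup (v $ i) t))"

definition saturation ::
  "int ^ 'n ^ 'm \<Rightarrow> ('r \<Rightarrow> int ^ 'm) \<Rightarrow>
   ('m::finite + 'n::finite, 'r::finite, 'k::comm_monoid_add) fvec \<Rightarrow> ('m + 'n, 'r, 'k) fvec"
  where "saturation W \<delta> U = hom W \<delta> (deh U)"

definition extension ::
  "int ^ 'n ^ 'm::{finite, linorder} \<Rightarrow>
   ('r \<Rightarrow> int ^ 'm::{finite, linorder}) \<Rightarrow> ('n::finite, 'r) mterm rel \<Rightarrow>
   ('m + 'n, 'r) mterm rel"
  where "extension W \<delta> \<sigma> = {(u, t).
    lex_less (term_deg (Wbar W) \<delta> u) (term_deg (Wbar W) \<delta> t) \<or>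
    term_deg (Wbar W) \<delta> u = term_deg (Wbar W) \<delta> t \<and> (deh_term u, deh_term t) \<in> \<sigma>}"

definition s_vector ::
  "('v, 'r) mterm rel \<Rightarrow> ('v::finite, 'r::finite, 'k::field) fvec \<Rightarrow> ('v, 'r, 'k) fvec \<Rightarrow>
   ('v, 'r, 'k) fvec"
  where "s_vector \<sigma> U V =
    (let t\<^sub>U = fst (lead_term \<sigma> U); t\<^sub>V = fst (lead_term \<sigma> V); l = pp_lcm t\<^sub>U t\<^sub>V
     in Poly_Mapping.single (l - t\<^sub>U) (1 / lead_coeff \<sigma> U) *s U
      - Poly_Mapping.single (l - t\<^sub>V) (1 / lead_coeff \<sigma> V) *s V)"

text \<open>
  The cancelled term is \<open>t LT(V)\<close>, which may be any term of \<open>Q\<close>, not just the leading one.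
\<close>

definition red_step ::
  "('v, 'r) mterm rel \<Rightarrow> ('v, 'r::finite, 'k::field) fvec set \<Rightarrow> ('v, 'r, 'k) fvec \<Rightarrow>
   ('v, 'r, 'k) fvec \<Rightarrow> bool"
  where "red_step \<sigma> G Q Q' \<longleftrightarrow> (\<exists>V \<in> G. \<exists>t. term_times t (lead_term \<sigma> V) \<in> mterms Q \<and>
    Q' = Q - Poly_Mapping.single t (mcoeff Q (term_times t (lead_term \<sigma> V)) / lead_coeff \<sigma> V) *s V)"

definition top_irreducible ::
  "('v, 'r) mterm rel \<Rightarrow> ('v, 'r::finite, 'k::field) fvec set \<Rightarrow> ('v, 'r, 'k) fvec \<Rightarrow> bool"
  where "top_irreducible \<sigma> G V \<longleftrightarrow> V = 0 \<or>
    (\<forall>U \<in> G. \<nexists>t. lead_term \<sigma> V = term_times t (lead_term \<sigma> U))"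

definition weak_sat_step ::
  "int ^ 'n ^ 'm \<Rightarrow> ('r \<Rightarrow> int ^ 'm) \<Rightarrow> ('m + 'n, 'r) mterm rel \<Rightarrow>
   ('m::finite + 'n::finite, 'r::finite, 'k::field) fvec set \<Rightarrow> ('m + 'n, 'r, 'k) fvec \<Rightarrow>
   ('m + 'n, 'r, 'k) fvec \<Rightarrow> bool"
  where "weak_sat_step W \<delta> \<sigma> G Q Q' \<longleftrightarrow> red_step \<sigma> G Q Q' \<or>
    homogeneous W \<delta> Q' \<and> saturation W \<delta> Q' = saturation W \<delta> Q"

definition weak_sat_remainder ::
  "int ^ 'n ^ 'm \<Rightarrow> ('r \<Rightarrow> int ^ 'm) \<Rightarrow> ('m + 'n, 'r) mterm rel \<Rightarrow>
   ('m::finite + 'n::finite, 'r::finite, 'k::field) fvec set \<Rightarrow> ('m + 'n, 'r, 'k) fvec \<Rightarrow>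
   ('m + 'n, 'r, 'k) fvec \<Rightarrow> bool"
  where "weak_sat_remainder W \<delta> \<sigma> G Q V \<longleftrightarrow>
    (weak_sat_step W \<delta> \<sigma> G)\<^sup>*\<^sup>* Q V \<and> top_irreducible \<sigma> G V"

text \<open>
  A state consists of the remaining generators, the remaining pairs and the tuple computed so far.
  Pairs whose leading terms lie in different components are never created.
\<close>

type_synonym ('v, 'r, 'k) bb_state =
  "('v, 'r, 'k) fvec multiset \<times> (('v, 'r, 'k) fvec \<times> ('v, 'r, 'k) fvec) set \<times> ('v, 'r, 'k) fvec list"

definition bb_add ::
  "('v, 'r) mterm rel \<Rightarrow> ('v, 'r::finite, 'k::field) fvec \<Rightarrow> ('v, 'r, 'k) bb_state \<Rightarrow>
   ('v, 'r, 'k) bb_state"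
  where "bb_add \<sigma> V = (\<lambda>(gens, pairs, G). if V = 0 then (gens, pairs, G) else
    (gens, pairs \<union> {(U, V) |U. U \<in> set G \<and> snd (lead_term \<sigma> U) = snd (lead_term \<sigma> V)}, G @ [V]))"

text \<open>
  A relation \<open>rem\<close>, with \<open>rem G Q V\<close> meaning that \<open>V\<close> is an admissible remainder of \<open>Q\<close> by \<open>G\<close>,
  is the parameter that distinguishes the variants of Buchberger's Algorithm.
\<close>

inductive bb_step ::
  "('v::finite, 'r) mterm rel \<Rightarrow>
   (('v, 'r::finite, 'k::field) fvec set \<Rightarrow> ('v, 'r, 'k) fvec \<Rightarrow> ('v, 'r, 'k) fvec \<Rightarrow> bool) \<Rightarrow>
   ('v, 'r, 'k) bb_state \<Rightarrow> ('v, 'r, 'k) bb_state \<Rightarrow> bool"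
  for \<sigma> rem where
  gen: "Q \<in># gens \<Longrightarrow> rem (set G) Q V \<Longrightarrow>
    bb_step \<sigma> rem (gens, pairs, G) (bb_add \<sigma> V (gens - {#Q#}, pairs, G))"
| pair: "(U, U') \<in> pairs \<Longrightarrow> rem (set G) (s_vector \<sigma> U U') V \<Longrightarrow>
    bb_step \<sigma> rem (gens, pairs, G) (bb_add \<sigma> V (gens, pairs - {(U, U')}, G))"

definition buchberger_output ::
  "('v::finite, 'r) mterm rel \<Rightarrow>
   (('v, 'r::finite, 'k::field) fvec set \<Rightarrow> ('v, 'r, 'k) fvec \<Rightarrow> ('v, 'r, 'k) fvec \<Rightarrow> bool) \<Rightarrow>
   ('v, 'r, 'k) fvec list \<Rightarrow> ('v, 'r, 'k) fvec list \<Rightarrow> bool"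
  where "buchberger_output \<sigma> rem us G \<longleftrightarrow> (bb_step \<sigma> rem)\<^sup>*\<^sup>* (mset us, {}, []) ({#}, {}, G)"

definition weak_self_sat_buchberger_output ::
  "int ^ 'n ^ 'm::{finite, linorder} \<Rightarrow>
   ('r \<Rightarrow> int ^ 'm::{finite, linorder}) \<Rightarrow> ('n, 'r) mterm rel \<Rightarrow>
   ('m + 'n::finite, 'r::finite, 'k::field) fvec list \<Rightarrow>
   ('m + 'n, 'r, 'k) fvec list \<Rightarrow> bool"
  where "weak_self_sat_buchberger_output W \<delta> \<sigma> =
    buchberger_output (extension W \<delta> \<sigma>) (weak_sat_remainder W \<delta> (extension W \<delta> \<sigma>))"

end

theory Submission
  imports Defs
begin

text \<open>
  A term in the \<open>y\<^sub>k\<close> and \<open>x\<^sub>j\<close> is determined by its degree and its dehomogenization, because the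
  degree and the exponents of the \<open>x\<^sub>j\<close> determine the exponents of the \<open>y\<^sub>k\<close>; and within one
  degree the extended ordering compares two terms by comparing their dehomogenizations with \<open>\<sigma>\<close>.
  Dehomogenization therefore commutes with leading terms, S-vectors and reduction steps of
  homogeneous vectors, and it does not notice a saturation step at all, since equal saturations
  dehomogenize equally. So a run of the algorithm, read in \<open>F\<close>, leaves these facts about its
  output \<open>V\<^sub>1, \<dots>, V\<^sub>t\<close>: the dehomogenizations \<open>g\<^sub>1, \<dots>, g\<^sub>t\<close> generate \<open>M\<close>, and the S-vector of any
  two of them in the same component is a sum of multiples \<open>c t g\<^sub>k\<close> such that every \<open>t LT(g\<^sub>k)\<close> is
  smaller than the lcm that the S-vector cancels (\<open>bb_invariant_steps\<close>).

  It remains to show Buchberger's criterion (\<open>buchberger_criterion\<close>): a finite set \<open>G\<close> with this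
  property of S-vectors has, for each non-zero \<open>f\<close> of its span, an element whose leading term
  divides \<open>LT(f)\<close>. The usual proof writes \<open>f\<close> as a sum of multiples of elements of \<open>G\<close> and lowers
  the largest leading term that occurs, using S-vectors, until it reaches \<open>LT(f)\<close>. As \<open>\<sigma>\<close> need not
  be well-founded, nothing in \<open>\<sigma>\<close> itself makes this stop. But for one given \<open>f\<close> the argument uses
  only finitely many comparisons: those inside the elements of \<open>G\<close>, inside \<open>f\<close>, and inside the
  chosen expressions of the S-vectors. Finitely many comparisons of a module ordering are also
  true for some real weights of the indeterminates and of the basis vectors, with a gap of at
  least 1 each time (\<open>weights_for_module_ordering\<close>). Lowering with respect to these weights makes
  the bound on the weights drop by 1 in every round (\<open>lower_weight_level\<close>), so that it reaches the
  weight of \<open>LT(f)\<close> after finitely many rounds.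
\<close>

section \<open>Weights that realize finitely many comparisons\<close>

definition pp_weight :: "('v::finite \<Rightarrow> real) \<Rightarrow> 'v pp \<Rightarrow> real"
  where "pp_weight w t = (\<Sum>x\<in>UNIV. w x * real (Poly_Mapping.lookup t x))"

definition term_weight :: "('v::finite \<Rightarrow> real) \<Rightarrow> ('r \<Rightarrow> real) \<Rightarrow> ('v, 'r) mterm \<Rightarrow> real"
  where "term_weight w \<beta> t = pp_weight w (fst t) + \<beta> (snd t)"

lemma pp_weight_add: "pp_weight w (s + t) = pp_weight w s + pp_weight w t"
  by (simp add: pp_weight_def lookup_add distrib_left sum.distrib)

lemma term_weight_term_times:
  "term_weight w \<beta> (term_times s t) = pp_weight w s + term_weight w \<beta> t"
  by (simp add: term_weight_def term_times_def pp_weight_add)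

lemma real_between_finite_sets:
  fixes f :: "'a \<Rightarrow> real" and g :: "'b \<Rightarrow> real"
  assumes fin: "finite P" "finite N" and less: "\<And>p n. p \<in> P \<Longrightarrow> n \<in> N \<Longrightarrow> f p < g n"
  obtains z where "\<And>p. p \<in> P \<Longrightarrow> f p < z" "\<And>n. n \<in> N \<Longrightarrow> z < g n"
proof -
  define A where "A = f ` P"
  define B where "B = g ` N"
  have AB: "finite A" "finite B" "\<And>a b. a \<in> A \<Longrightarrow> b \<in> B \<Longrightarrow> a < b"
    using fin less by (auto simp: A_def B_def)
  have "\<exists>z. (\<forall>a\<in>A. a < z) \<and> (\<forall>b\<in>B. z < b)"
  proof (cases "A = {} \<or> B = {}")
    case True
    then show ?thesis
    proof
      assume "A = {}"
      moreover have "Min (insert 0 B) - 1 < b" if "b \<in> B" for b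
      proof -
        have "Min (insert 0 B) \<le> b" using AB(2) that by (intro Min_le) auto
        then show ?thesis by linarith
      qed
      ultimately show ?thesis by (intro exI[of _ "Min (insert 0 B) - 1"]) auto
    next
      assume "B = {}"
      moreover have "a < Max (insert 0 A) + 1" if "a \<in> A" for a
      proof -
        have "a \<le> Max (insert 0 A)" using AB(1) that by (intro Max_ge) auto
        then show ?thesis by linarith
      qed
      ultimately show ?thesis by (intro exI[of _ "Max (insert 0 A) + 1"]) auto
    qed
  next
    case False
    then have "Max A < Min B" using AB by simp
    then obtain z where "Max A < z" "z < Min B" using dense by blast
    then show ?thesis using False AB by (intro exI[of _ z]) auto
  qed
  then show thesis using that by (auto simp: A_def B_def)
qed

text \<open>
  Fourier-Motzkin elimination. To remove the coordinate \<open>k\<close>, each vector that is positive at \<open>k\<close>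
  is combined with each one that is negative at \<open>k\<close> so that the entry at \<open>k\<close> cancels. The
  combinations stay in \<open>C\<close>, and a functional that is positive on them leaves an open interval for
  the missing value at \<open>k\<close>. When no coordinate is left, only the zero vector could remain, and it
  is not in \<open>C\<close>.
\<close>

lemma positive_functional_on_finite_set:
  fixes C :: "('v \<Rightarrow> int) set"
  assumes add: "\<And>a b. a \<in> C \<Longrightarrow> b \<in> C \<Longrightarrow> (\<lambda>x. a x + b x) \<in> C" and zero: "(\<lambda>_. 0) \<notin> C"
    and "finite X" "finite D" "D \<subseteq> C" "\<And>d x. d \<in> D \<Longrightarrow> x \<notin> X \<Longrightarrow> d x = 0"
  shows "\<exists>w :: 'v \<Rightarrow> real. \<forall>d\<in>D. (\<Sum>x\<in>X. w x * real_of_int (d x)) > 0"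
  using assms(3-)
proof (induction X arbitrary: D rule: finite_induct)
  case empty
  have False if "d \<in> D" for d
  proof -
    have "d = (\<lambda>_. 0)" using empty(3) that by auto
    then show False using empty(2) that zero by auto
  qed
  then show ?case by blast
next
  case (insert k X)
  have multiple: "(\<lambda>x. int n * a x) \<in> C" if "a \<in> C" "n > 0" for a n
    using that(2)
  proof (induction n rule: nat_induct_non_zero)
    case 1
    then show ?case using that(1) by simp
  next
    case (Suc n)
    then show ?case using add[OF Suc.IH that(1)] by (simp add: algebra_simps)
  qed
  define P where "P = {d \<in> D. d k > 0}"
  define N where "N = {d \<in> D. d k < 0}"
  define Z where "Z = {d \<in> D. d k = 0}"
  define comb :: "('v \<Rightarrow> int) \<Rightarrow> ('v \<Rightarrow> int) \<Rightarrow> 'v \<Rightarrow> int"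
    where "comb p n = (\<lambda>x. (- n k) * p x + p k * n x)" for p n
  define D' where "D' = Z \<union> (\<lambda>(p, n). comb p n) ` (P \<times> N)"
  have comb_C: "comb p n \<in> C" if "p \<in> P" "n \<in> N" for p n
  proof -
    have "(\<lambda>x. int (nat (- n k)) * p x) \<in> C" "(\<lambda>x. int (nat (p k)) * n x) \<in> C"
      using that insert.prems(2) by (intro multiple; force simp: P_def N_def)+
    from add[OF this] show ?thesis using that by (simp add: comb_def P_def N_def)
  qed
  have "finite D'" using insert.prems(1) by (auto simp: D'_def Z_def P_def N_def)
  moreover have "D' \<subseteq> C" using comb_C insert.prems(2) by (auto simp: D'_def Z_def)
  moreover have "d x = 0" if d: "d \<in> D'" and x: "x \<notin> X" for d x
  proof (cases "x = k")
    case True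
    then show ?thesis using d by (auto simp: D'_def Z_def comb_def)
  next
    case False
    then have vanish: "e x = 0" if "e \<in> D" for e using insert.prems(3)[of e x] x that by simp
    consider "d \<in> D" | p n where "p \<in> D" "n \<in> D" "d = comb p n"
      using d by (auto simp: D'_def Z_def P_def N_def)
    then show ?thesis by cases (simp_all add: vanish comb_def)
  qed
  ultimately obtain w :: "'v \<Rightarrow> real"
    where w: "\<forall>d\<in>D'. (\<Sum>x\<in>X. w x * real_of_int (d x)) > 0"
    using insert.IH by blast
  define val where "val d = (\<Sum>x\<in>X. w x * real_of_int (d x))" for d :: "'v \<Rightarrow> int"
  have val_comb: "val (comb p n) = real_of_int (- n k) * val p + real_of_int (p k) * val n" for p n
    unfolding val_def sum_distrib_left sum.distrib[symmetric]
    by (rule sum.cong) (auto simp: comb_def algebra_simps)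
  have less: "- val p / p k < val n / (- n k)" if pn: "p \<in> P" "n \<in> N" for p n
  proof -
    have "val (comb p n) > 0" using w pn by (force simp: D'_def val_def)
    moreover have "real_of_int (p k) > 0" "real_of_int (- n k) > 0"
      using pn by (auto simp: P_def N_def)
    ultimately show ?thesis unfolding val_comb
      by (simp add: divide_simps split: if_splits) (simp add: algebra_simps)
  qed
  have "finite P" "finite N" using insert.prems(1) by (auto simp: P_def N_def)
  from real_between_finite_sets[where f = "\<lambda>p. - val p / p k" and g = "\<lambda>n. val n / (- n k)",
      OF this less]
  obtain z where z: "\<And>p. p \<in> P \<Longrightarrow> - val p / p k < z" "\<And>n. n \<in> N \<Longrightarrow> z < val n / (- n k)"
    by blast
  have "(\<Sum>x\<in>insert k X. (w(k := z)) x * real_of_int (d x)) > 0" if d: "d \<in> D" for d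
  proof -
    have "(\<Sum>x\<in>insert k X. (w(k := z)) x * real_of_int (d x)) = z * d k + val d"
      using insert.hyps by (simp add: val_def) (intro sum.cong, auto)
    moreover have "z * d k + val d > 0"
    proof (cases "d k" "0 :: int" rule: linorder_cases)
      case less
      with d have dN: "d \<in> N" by (simp add: N_def)
      have dk: "- real_of_int (d k) > 0" using less by simp
      have "z * (- real_of_int (d k)) < val d"
        using z(2)[OF dN] pos_less_divide_eq[OF dk, of z "val d"] by simp
      then show ?thesis by simp
    next
      case equal
      then show ?thesis using w d by (simp add: D'_def Z_def val_def)
    next
      case greater
      with d have "d \<in> P" by (simp add: P_def)
      from z(1)[OF this] greater show ?thesis by (simp add: divide_simps)
    qed
    ultimately show ?thesis by simp
  qed
  then show ?case by blast
qed

lemma module_orderingD: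
  assumes "module_ordering \<sigma>"
  shows "(u, u) \<notin> \<sigma>" and "(u, t) \<in> \<sigma> \<Longrightarrow> (t, v) \<in> \<sigma> \<Longrightarrow> (u, v) \<in> \<sigma>"
    and "u \<noteq> t \<Longrightarrow> (u, t) \<in> \<sigma> \<or> (t, u) \<in> \<sigma>"
    and "(u, t) \<in> \<sigma> \<Longrightarrow> (term_times s u, term_times s t) \<in> \<sigma>"
proof -
  have *: "strict_linear_order \<sigma>"
    and m: "\<And>u t s. (u, t) \<in> \<sigma> \<Longrightarrow> (term_times s u, term_times s t) \<in> \<sigma>"
    using assms by (auto simp: module_ordering_def)
  show "(u, u) \<notin> \<sigma>" using * unfolding strict_linear_order_on_def irrefl_def by blast
  show "(u, t) \<in> \<sigma> \<Longrightarrow> (t, v) \<in> \<sigma> \<Longrightarrow> (u, v) \<in> \<sigma>"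
    using * by (auto simp: strict_linear_order_on_def elim: transE)
  show "u \<noteq> t \<Longrightarrow> (u, t) \<in> \<sigma> \<or> (t, u) \<in> \<sigma>"
    using * unfolding strict_linear_order_on_def total_on_def by blast
  show "(u, t) \<in> \<sigma> \<Longrightarrow> (term_times s u, term_times s t) \<in> \<sigma>" by (rule m)
qed

text \<open>
  The differences of exponent vectors of comparable power products form a set to which the
  elimination applies: comparisons can be added, and only equal power products have difference 0.
\<close>

lemma weights_for_monoid_ordering:
  fixes \<tau> :: "'v::finite pp rel"
  assumes \<tau>: "monoid_ordering \<tau>" and fin: "finite E" and sub: "E \<subseteq> \<tau>"
  shows "\<exists>w. \<forall>(u, t)\<in>E. pp_weight w u < pp_weight w t"
proof -
  define diff :: "'v pp \<times> 'v pp \<Rightarrow> 'v \<Rightarrow> int"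
    where "diff = (\<lambda>(u, t) x. int (Poly_Mapping.lookup t x) - int (Poly_Mapping.lookup u x))"
  have slo: "strict_linear_order \<tau>" and mult: "\<And>u t s. (u, t) \<in> \<tau> \<Longrightarrow> (s + u, s + t) \<in> \<tau>"
    using \<tau> by (auto simp: monoid_ordering_def)
  have add: "(\<lambda>x. a x + b x) \<in> diff ` \<tau>" if "a \<in> diff ` \<tau>" "b \<in> diff ` \<tau>" for a b
  proof -
    from that obtain p p' where "p \<in> \<tau>" "a = diff p" "p' \<in> \<tau>" "b = diff p'" by blast
    then obtain u t u' t'
      where *: "(u, t) \<in> \<tau>" "a = diff (u, t)" "(u', t') \<in> \<tau>" "b = diff (u', t')"
      by (cases p; cases p') auto
    have "(u' + u, u' + t) \<in> \<tau>" "(t + u', t + t') \<in> \<tau>" using mult * by blast+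
    then have "(u' + u, t + t') \<in> \<tau>"
      using slo unfolding strict_linear_order_on_def by (metis add.commute transD)
    then have "(u + u', t + t') \<in> \<tau>" by (simp add: add.commute)
    moreover have "(\<lambda>x. a x + b x) = diff (u + u', t + t')" by (auto simp: * diff_def lookup_add)
    ultimately show ?thesis by blast
  qed
  have zero: "(\<lambda>_. 0) \<notin> diff ` \<tau>"
  proof
    assume "(\<lambda>_. 0) \<in> diff ` \<tau>"
    then obtain p where "p \<in> \<tau>" "(\<lambda>_. 0) = diff p" by blast
    then obtain u t where ut: "(u, t) \<in> \<tau>" and d: "(\<lambda>_. 0) = diff (u, t)" by (cases p) auto
    have "u = t"
    proof (rule poly_mapping_eqI)
      fix x
      show "Poly_Mapping.lookup u x = Poly_Mapping.lookup t x"
        using fun_cong[OF d, of x] by (simp add: diff_def)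
    qed
    then show False using ut slo by (auto simp: strict_linear_order_on_def irrefl_def)
  qed
  obtain w :: "'v \<Rightarrow> real" where w: "\<forall>d\<in>diff ` E. (\<Sum>x\<in>UNIV. w x * real_of_int (d x)) > 0"
    using positive_functional_on_finite_set[OF add zero finite[of UNIV] finite_imageI[OF fin, of diff]
        image_mono[OF sub]] by blast
  have "pp_weight w u < pp_weight w t" if "(u, t) \<in> E" for u t
  proof -
    have "(\<Sum>x\<in>UNIV. w x * real_of_int (diff (u, t) x)) > 0" using w that by blast
    then show ?thesis
      by (simp add: diff_def pp_weight_def right_diff_distrib sum_subtractf)
  qed
  then show ?thesis by blast
qed

text \<open>
  The compatible monoid ordering is total, so inside one component it does not just imply \<open>\<sigma>\<close> but
  agrees with it.
\<close>

lemma same_component_imp_monoid_ordering: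
  assumes "module_ordering \<sigma>"
  obtains \<tau> where "monoid_ordering \<tau>" "\<And>u t. (u, t) \<in> \<sigma> \<Longrightarrow> snd u = snd t \<Longrightarrow> (fst u, fst t) \<in> \<tau>"
proof -
  obtain \<tau> where \<tau>: "monoid_ordering \<tau>" and c: "\<And>u t i. (u, t) \<in> \<tau> \<Longrightarrow> ((u, i), (t, i)) \<in> \<sigma>"
    using assms by (auto simp: module_ordering_def)
  have "(fst u, fst t) \<in> \<tau>" if ut: "(u, t) \<in> \<sigma>" "snd u = snd t" for u t
  proof (rule ccontr)
    assume "(fst u, fst t) \<notin> \<tau>"
    moreover have "fst u \<noteq> fst t" using ut module_orderingD(1)[OF assms] by (metis prod.expand)
    ultimately have "(fst t, fst u) \<in> \<tau>"
      using \<tau> by (auto simp: monoid_ordering_def strict_linear_order_on_def total_on_def)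
    from c[OF this, of "snd u"] have "(t, u) \<in> \<sigma>" using ut(2) by (metis prod.collapse)
    then show False using module_orderingD[OF assms] ut(1) by blast
  qed
  with \<tau> show thesis by (rule that)
qed

text \<open>
  A comparison is viewed as an edge between the components of its two terms, and the weights of
  the basis vectors are eliminated one by one. To remove the component \<open>i\<close>, a comparison whose
  larger term lies in \<open>i\<close> is chained with one whose smaller term lies in \<open>i\<close>, after multiplication
  by power products that make these two terms equal. In the end all edges are loops, where \<open>\<sigma>\<close> is
  given by a monoid ordering.
\<close>

lemma weights_for_edges:
  fixes \<sigma> :: "('v::finite, 'r) mterm rel"
  assumes \<sigma>: "module_ordering \<sigma>" and "finite I" "finite E" "E \<subseteq> \<sigma>"
    "\<And>u t. (u, t) \<in> E \<Longrightarrow> snd u \<noteq> snd t \<Longrightarrow> snd u \<in> I \<and> snd t \<in> I"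
  shows "\<exists>w \<beta>. \<forall>(u, t)\<in>E. term_weight w \<beta> u < term_weight w \<beta> t"
  using assms(2-)
proof (induction I arbitrary: E rule: finite_induct)
  case empty
  obtain \<tau> where \<tau>: "monoid_ordering \<tau>"
      and c: "\<And>u t. (u, t) \<in> \<sigma> \<Longrightarrow> snd u = snd t \<Longrightarrow> (fst u, fst t) \<in> \<tau>"
    using same_component_imp_monoid_ordering[OF \<sigma>] by blast
  have loop: "snd u = snd t" if "(u, t) \<in> E" for u t using empty.prems(3) that by blast
  have "(\<lambda>(u, t). (fst u, fst t)) ` E \<subseteq> \<tau>"
  proof clarify
    fix u t
    assume "(u, t) \<in> E"
    with loop c empty.prems(2) show "(fst u, fst t) \<in> \<tau>" by blast
  qed
  from weights_for_monoid_ordering[OF \<tau> _ this] empty.prems(1)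
  obtain w where w: "\<forall>(u, t)\<in>(\<lambda>(u, t). (fst u, fst t)) ` E. pp_weight w u < pp_weight w t"
    by blast
  have "term_weight w (\<lambda>_. 0) u < term_weight w (\<lambda>_. 0) t" if "(u, t) \<in> E" for u t
    using bspec[OF w imageI[OF that]] by (simp add: term_weight_def)
  then show ?case by blast
next
  case (insert i I)
  define P where "P = {(u, t) \<in> E. snd t = i \<and> snd u \<noteq> i}"
  define N where "N = {(u, t) \<in> E. snd u = i \<and> snd t \<noteq> i}"
  define comb :: "('v, 'r) mterm \<times> ('v, 'r) mterm \<Rightarrow> ('v, 'r) mterm \<times> ('v, 'r) mterm
      \<Rightarrow> ('v, 'r) mterm \<times> ('v, 'r) mterm"
    where "comb = (\<lambda>(u, t) (u', t'). (term_times (fst u') u, term_times (fst t) t'))"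
  define E' where "E' = (E - P - N) \<union> (\<lambda>(p, n). comb p n) ` (P \<times> N)"
  have comb_\<sigma>: "comb p n \<in> \<sigma>" if pn: "p \<in> P" "n \<in> N" for p n
  proof -
    obtain u t where p: "p = (u, t)" "(u, t) \<in> \<sigma>" "snd t = i"
      using pn(1) insert.prems(2) by (auto simp: P_def)
    obtain u' t' where n: "n = (u', t')" "(u', t') \<in> \<sigma>" "snd u' = i"
      using pn(2) insert.prems(2) by (auto simp: N_def)
    have "term_times (fst u') t = term_times (fst t) u'"
      using p n by (simp add: term_times_def add.commute)
    moreover have "(term_times (fst u') u, term_times (fst u') t) \<in> \<sigma>"
      "(term_times (fst t) u', term_times (fst t) t') \<in> \<sigma>"
      using module_orderingD(4)[OF \<sigma>] p n by auto
    ultimately show ?thesis using module_orderingD(2)[OF \<sigma>] by (auto simp: comb_def p n)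
  qed
  have "finite P" "finite N"
    using insert.prems(1) by (auto simp: P_def N_def intro: finite_subset[rotated])
  then have "finite E'" using insert.prems(1) by (simp add: E'_def)
  moreover have "E' \<subseteq> \<sigma>" using comb_\<sigma> insert.prems(2) by (auto simp: E'_def)
  moreover have "snd u \<in> I \<and> snd t \<in> I" if ut: "(u, t) \<in> E'" "snd u \<noteq> snd t" for u t
  proof (cases "(u, t) \<in> E - P - N")
    case True
    then show ?thesis using insert.prems(3)[of u t] ut(2) by (auto simp: P_def N_def)
  next
    case False
    then have "(u, t) \<in> (\<lambda>(p, n). comb p n) ` (P \<times> N)" using ut(1) unfolding E'_def by blast
    then obtain p n where pn: "p \<in> P" "n \<in> N" "(u, t) = comb p n" by auto
    obtain a b where p: "p = (a, b)" by (cases p)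
    obtain c d where n: "n = (c, d)" by (cases n)
    have *: "(a, b) \<in> P" "(c, d) \<in> N" "(u, t) = comb (a, b) (c, d)" using pn p n by simp_all
    have "snd u = snd a" "snd t = snd d" using *(3) by (auto simp: comb_def term_times_def)
    then show ?thesis using *(1,2) insert.prems(3)[of a b] insert.prems(3)[of c d]
      by (auto simp: P_def N_def)
  qed
  ultimately obtain w \<beta> where w: "\<forall>(u, t)\<in>E'. term_weight w \<beta> u < term_weight w \<beta> t"
    using insert.IH by blast
  have lt: "term_weight w \<beta> (fst p) - pp_weight w (fst (snd p))
      < term_weight w \<beta> (snd n) - pp_weight w (fst (fst n))" if "p \<in> P" "n \<in> N" for p n
  proof -
    have "comb p n \<in> E'" using that by (force simp: E'_def)
    then show ?thesis using w
      by (cases p; cases n) (auto simp: comb_def term_weight_term_times)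
  qed
  obtain z where z: "\<And>p. p \<in> P \<Longrightarrow> term_weight w \<beta> (fst p) - pp_weight w (fst (snd p)) < z"
      "\<And>n. n \<in> N \<Longrightarrow> z < term_weight w \<beta> (snd n) - pp_weight w (fst (fst n))"
    using real_between_finite_sets[OF \<open>finite P\<close> \<open>finite N\<close>,
        of "\<lambda>p. term_weight w \<beta> (fst p) - pp_weight w (fst (snd p))"
          "\<lambda>n. term_weight w \<beta> (snd n) - pp_weight w (fst (fst n))"] lt
    by blast
  have "term_weight w (\<beta>(i := z)) u < term_weight w (\<beta>(i := z)) t" if e: "(u, t) \<in> E" for u t
  proof -
    consider "(u, t) \<in> P" | "(u, t) \<in> N" | "(u, t) \<in> E'" "snd u \<noteq> i" "snd t \<noteq> i"
      | "(u, t) \<in> E'" "snd u = i" "snd t = i"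
      using e by (auto simp: E'_def P_def N_def)
    then show ?thesis
    proof cases
      case 1
      then show ?thesis using z(1)[OF 1] by (auto simp: P_def term_weight_def)
    next
      case 2
      then show ?thesis using z(2)[OF 2] by (auto simp: N_def term_weight_def)
    next
      case 3
      then show ?thesis using w by (auto simp: term_weight_def)
    next
      case 4
      then show ?thesis using w by (auto simp: term_weight_def)
    qed
  qed
  then show ?case by blast
qed

lemma weights_for_module_ordering:
  fixes \<sigma> :: "('v::finite, 'r::finite) mterm rel"
  assumes \<sigma>: "module_ordering \<sigma>" and fin: "finite E" and sub: "E \<subseteq> \<sigma>"
  shows "\<exists>w \<beta>. \<forall>u t. (u, t) \<in> E \<longrightarrow> term_weight w \<beta> u + 1 \<le> term_weight w \<beta> t"
proof -
  obtain w \<beta> where w: "\<forall>(u, t)\<in>E. term_weight w \<beta> u < term_weight w \<beta> t"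
    using weights_for_edges[OF \<sigma> finite[of UNIV] fin sub] by auto
  \<comment> \<open>Dividing by a positive lower bound of the finitely many gaps makes all gaps at least 1.\<close>
  obtain \<epsilon> where "\<epsilon> > 0" and \<epsilon>: "\<And>e. e \<in> E \<Longrightarrow> \<epsilon> < term_weight w \<beta> (snd e) - term_weight w \<beta> (fst e)"
  proof (rule real_between_finite_sets[of "{()}" E "\<lambda>_. 0"
        "\<lambda>e. term_weight w \<beta> (snd e) - term_weight w \<beta> (fst e)"])
    show "0 < term_weight w \<beta> (snd e) - term_weight w \<beta> (fst e)" if "e \<in> E" for e
      using bspec[OF w that] by (simp add: case_prod_beta)
  qed (use fin in blast)+
  have scale: "term_weight (\<lambda>x. w x / \<epsilon>) (\<lambda>i. \<beta> i / \<epsilon>) t = term_weight w \<beta> t / \<epsilon>" for t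
    by (simp add: term_weight_def pp_weight_def add_divide_distrib sum_divide_distrib)
  show ?thesis
  proof (intro exI allI impI)
    fix u t
    assume "(u, t) \<in> E"
    from \<epsilon>[OF this, simplified] \<open>\<epsilon> > 0\<close>
    show "term_weight (\<lambda>x. w x / \<epsilon>) (\<lambda>i. \<beta> i / \<epsilon>) u + 1 \<le> term_weight (\<lambda>x. w x / \<epsilon>) (\<lambda>i. \<beta> i / \<epsilon>) t"
      unfolding scale using divide_right_mono[of "term_weight w \<beta> u + \<epsilon>" "term_weight w \<beta> t" \<epsilon>]
      by (simp add: add_divide_distrib)
  qed
qed

section \<open>Vectors as combinations with controlled leading terms\<close>

lemma mem_mterms: "t \<in> mterms v \<longleftrightarrow> mcoeff v t \<noteq> 0"
  by (cases t) (simp add: mterms_def mcoeff_def in_keys_iff)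

lemma finite_mterms [simp]: "finite (mterms v)"
proof -
  have "mterms v = (\<Union>i\<in>UNIV. (\<lambda>t. (t, i)) ` Poly_Mapping.keys (v $ i))"
    by (auto simp: mterms_def)
  then show ?thesis by simp
qed

lemma fvec_eqI:
  assumes "\<And>t. mcoeff u t = mcoeff v t"
  shows "u = v"
  using assms by (auto simp: vec_eq_iff mcoeff_def intro!: poly_mapping_eqI)

lemma mcoeff_zero [simp]: "mcoeff 0 t = 0"
  by (simp add: mcoeff_def)

lemma mcoeff_add [simp]: "mcoeff (u + v) t = mcoeff u t + mcoeff v t"
  by (simp add: mcoeff_def lookup_add)

lemma mcoeff_diff [simp]: "mcoeff (u - v) t = mcoeff u t - mcoeff v t"
  for u v :: "('v, 'r::finite, 'k::field) fvec"
  by (simp add: mcoeff_def lookup_minus)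

lemma mcoeff_sum: "mcoeff (sum f A) t = (\<Sum>a\<in>A. mcoeff (f a) t)"
  by (induction A rule: infinite_finite_induct) auto

lemma lookup_single_times:
  fixes p :: "('v, 'k::field) mpol"
  shows "Poly_Mapping.lookup (Poly_Mapping.single s c * p) (s + t) = c * Poly_Mapping.lookup p t"
  by (simp add: lookup_mult lookup_single when_mult)

lemma mcoeff_single_scale [simp]:
  fixes v :: "('v, 'r::finite, 'k::field) fvec"
  shows "mcoeff (Poly_Mapping.single s c *s v) (term_times s t) = c * mcoeff v t"
  by (simp add: mcoeff_def term_times_def lookup_single_times)

lemma mterms_single_scale:
  fixes v :: "('v, 'r::finite, 'k::field) fvec"
  shows "mterms (Poly_Mapping.single s c *s v) \<subseteq> term_times s ` mterms v"
proof clarify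
  fix t i
  assume "(t, i) \<in> mterms (Poly_Mapping.single s c *s v)"
  then have "t \<in> Poly_Mapping.keys (Poly_Mapping.single s c * v $ i)" by (simp add: mterms_def)
  then obtain a b where "a \<in> Poly_Mapping.keys (Poly_Mapping.single s c)"
      "b \<in> Poly_Mapping.keys (v $ i)" "t = a + b"
    using keys_mult by blast
  then have "(b, i) \<in> mterms v" "(t, i) = term_times s (b, i)"
    by (auto simp: mterms_def term_times_def split: if_splits)
  then show "(t, i) \<in> term_times s ` mterms v" by blast
qed

lemma mterms_add: "mterms (u + v) \<subseteq> mterms u \<union> mterms v"
  by (auto simp: mem_mterms)

lemma mterms_diff: "mterms (u - v) \<subseteq> mterms u \<union> mterms v"
  for u v :: "('v, 'r::finite, 'k::field) fvec"
  by (auto simp: mem_mterms)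

lemma mterms_eq_empty_iff: "mterms v = {} \<longleftrightarrow> v = 0"
  by (metis ex_in_conv fvec_eqI mcoeff_zero mem_mterms)

lemma term_times_term_times: "term_times s (term_times s' t) = term_times (s + s') t"
  by (simp add: term_times_def add.assoc)

lemma lead_term_eqI:
  assumes "t \<in> mterms v" "\<And>u. u \<in> mterms v \<Longrightarrow> u \<noteq> t \<Longrightarrow> (u, t) \<in> \<rho>"
    and "\<And>u. u \<in> mterms v \<Longrightarrow> u \<noteq> t \<Longrightarrow> (t, u) \<notin> \<rho>"
  shows "lead_term \<rho> v = t"
  unfolding lead_term_def
proof (rule the_equality)
  show "t \<in> mterms v \<and> (\<forall>u\<in>mterms v. u \<noteq> t \<longrightarrow> (u, t) \<in> \<rho>)" using assms by blast
next
  fix t'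
  assume "t' \<in> mterms v \<and> (\<forall>u\<in>mterms v. u \<noteq> t' \<longrightarrow> (u, t') \<in> \<rho>)"
  then show "t' = t" using assms(1,3) by metis
qed

lemma lead_term_greatest:
  assumes \<sigma>: "module_ordering \<sigma>" and "v \<noteq> 0"
  shows "lead_term \<sigma> v \<in> mterms v"
    and "u \<in> mterms v \<Longrightarrow> u \<noteq> lead_term \<sigma> v \<Longrightarrow> (u, lead_term \<sigma> v) \<in> \<sigma>"
proof -
  have "\<exists>t\<in>A. \<forall>u\<in>A. u \<noteq> t \<longrightarrow> (u, t) \<in> \<sigma>" if "finite A" "A \<noteq> {}" for A
    using that
  proof (induction A rule: finite_ne_induct)
    case (singleton x)
    then show ?case by simp
  next
    case (insert x A)
    then obtain t where t: "t \<in> A" "\<forall>u\<in>A. u \<noteq> t \<longrightarrow> (u, t) \<in> \<sigma>" by blast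
    have "(x, t) \<in> \<sigma> \<or> (t, x) \<in> \<sigma>" using module_orderingD(3)[OF \<sigma>] t(1) insert.hyps by metis
    then show ?case using t module_orderingD(2)[OF \<sigma>] by (metis insert_iff)
  qed
  from this[of "mterms v"] obtain t
    where t: "t \<in> mterms v" "\<forall>u\<in>mterms v. u \<noteq> t \<longrightarrow> (u, t) \<in> \<sigma>"
    using \<open>v \<noteq> 0\<close> by (auto simp: mterms_eq_empty_iff)
  have "lead_term \<sigma> v = t"
    using t module_orderingD(1,2)[OF \<sigma>] by (intro lead_term_eqI) blast+
  with t show "lead_term \<sigma> v \<in> mterms v"
    and "u \<in> mterms v \<Longrightarrow> u \<noteq> lead_term \<sigma> v \<Longrightarrow> (u, lead_term \<sigma> v) \<in> \<sigma>"
    by auto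
qed

lemma lead_coeff_nonzero:
  assumes "module_ordering \<sigma>" "v \<noteq> 0"
  shows "lead_coeff \<sigma> v \<noteq> 0"
  using lead_term_greatest(1)[OF assms] by (simp add: lead_coeff_def mem_mterms)

text \<open>
  The membership \<open>v \<in> std_span \<sigma> G A\<close> records the leading terms of the summands and not only the
  terms of \<open>v\<close>: the former may be larger and cancel in the sum. With \<open>A\<close> the set of terms below a
  bound, this is a bounded (standard) representation of \<open>v\<close>; with \<open>A = UNIV\<close> it is membership in
  the span of \<open>G\<close>.
\<close>

inductive_set std_span ::
  "('v, 'r) mterm rel \<Rightarrow> ('v, 'r::finite, 'k::field) fvec set \<Rightarrow> ('v, 'r) mterm set \<Rightarrow>
   ('v, 'r, 'k) fvec set"
  for \<sigma> G A where
  zero: "0 \<in> std_span \<sigma> G A"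
| step: "v \<in> std_span \<sigma> G A \<Longrightarrow> g \<in> G \<Longrightarrow> term_times s (lead_term \<sigma> g) \<in> A \<Longrightarrow>
    Poly_Mapping.single s c *s g + v \<in> std_span \<sigma> G A"

lemma std_span_mono:
  assumes "v \<in> std_span \<sigma> G A" "G \<subseteq> H" "A \<subseteq> B"
  shows "v \<in> std_span \<sigma> H B"
  using assms by (induction rule: std_span.induct) (auto intro: std_span.intros)

lemma std_span_base:
  assumes "g \<in> G" "term_times s (lead_term \<sigma> g) \<in> A"
  shows "Poly_Mapping.single s c *s g \<in> std_span \<sigma> G A"
  using std_span.step[OF std_span.zero assms] by simp

lemma std_span_add:
  assumes "u \<in> std_span \<sigma> G A" "v \<in> std_span \<sigma> G A"
  shows "u + v \<in> std_span \<sigma> G A"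
  using assms by (induction rule: std_span.induct) (auto simp: add.assoc intro: std_span.step)

lemma std_span_scale:
  assumes "v \<in> std_span \<sigma> G A"
  shows "Poly_Mapping.single m a *s v \<in> std_span \<sigma> G (term_times m ` A)"
  using assms
proof (induction rule: std_span.induct)
  case zero
  then show ?case by (simp add: std_span.zero)
next
  case (step v g s c)
  have "Poly_Mapping.single (m + s) (a * c) *s g + Poly_Mapping.single m a *s v
      \<in> std_span \<sigma> G (term_times m ` A)"
    using step.hyps by (intro std_span.step step.IH) (auto simp flip: term_times_term_times)
  then show ?case by (simp add: vector_add_ldistrib mult_single)
qed

lemma std_span_uminus:
  assumes "v \<in> std_span \<sigma> G A"
  shows "- v \<in> std_span \<sigma> G A"
proof -
  have "term_times 0 ` A = A" by (simp add: term_times_def)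
  then show ?thesis using std_span_scale[OF assms, of 0 "- 1"]
    by (simp add: single_uminus vector_sneg_minus1[symmetric])
qed

lemma std_span_sum:
  assumes "\<And>x. x \<in> X \<Longrightarrow> f x \<in> std_span \<sigma> G A"
  shows "sum f X \<in> std_span \<sigma> G A"
  using assms
  by (induction X rule: infinite_finite_induct) (auto intro: std_span_add std_span.zero)

text \<open>
  This lets a bound by an ordering be replaced by finitely many comparisons.
\<close>

lemma std_span_finite:
  assumes "v \<in> std_span \<sigma> G A"
  obtains A\<^sub>0 where "finite A\<^sub>0" "A\<^sub>0 \<subseteq> A" "v \<in> std_span \<sigma> G A\<^sub>0"
proof -
  have "\<exists>A\<^sub>0. finite A\<^sub>0 \<and> A\<^sub>0 \<subseteq> A \<and> v \<in> std_span \<sigma> G A\<^sub>0"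
    using assms
  proof (induction rule: std_span.induct)
    case zero
    then show ?case using std_span.zero by blast
  next
    case (step v g s c)
    then obtain A\<^sub>0 where A: "finite A\<^sub>0" "A\<^sub>0 \<subseteq> A" "v \<in> std_span \<sigma> G A\<^sub>0" by blast
    have "Poly_Mapping.single s c *s g + v
        \<in> std_span \<sigma> G (insert (term_times s (lead_term \<sigma> g)) A\<^sub>0)"
      using A(3) step.hyps(2) by (auto intro!: std_span.step elim: std_span_mono)
    then show ?case using A step.hyps(3) by (intro exI conjI) auto
  qed
  then show thesis using that by blast
qed

lemma poly_mapping_sum_singles:
  "p = (\<Sum>t\<in>Poly_Mapping.keys p. Poly_Mapping.single t (Poly_Mapping.lookup p t))"
  by (rule poly_mapping_eqI)
     (simp add: lookup_sum lookup_single when_def sum.delta in_keys_iff)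

lemma sum_scale: "sum f X *s v = (\<Sum>x\<in>X. f x *s v)"
  for v :: "'a::comm_ring_1 ^ 'r"
  by (induction X rule: infinite_finite_induct) (simp_all add: vector_sadd_rdistrib)

lemma span_subset_std_span:
  fixes G :: "('v::finite, 'r::finite, 'k::field) fvec set"
  shows "module.span (*s) G \<subseteq> std_span \<sigma> G UNIV"
proof
  fix v
  assume "v \<in> module.span (*s) G"
  then show "v \<in> std_span \<sigma> G UNIV"
  proof (induction rule: module.span_induct_alt[OF module_vec, consumes 1])
    case 1
    then show ?case by (rule std_span.zero)
  next
    case (2 p g v)
    have "p *s g = (\<Sum>t\<in>Poly_Mapping.keys p. Poly_Mapping.single t (Poly_Mapping.lookup p t) *s g)"
      by (subst poly_mapping_sum_singles) (simp only: sum_scale)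
    then have "p *s g \<in> std_span \<sigma> G UNIV"
      using 2(1) by (auto intro!: std_span_sum std_span_base)
    then show ?case using 2(2) by (rule std_span_add)
  qed
qed

lemma std_span_subset_span: "std_span \<sigma> G A \<subseteq> module.span (*s) G"
proof
  fix v
  assume "v \<in> std_span \<sigma> G A"
  then show "v \<in> module.span (*s) G"
    by induction (auto intro: module.span_zero[OF module_vec] module.span_add[OF module_vec]
        module.span_scale[OF module_vec] module.span_base[OF module_vec])
qed

lemma pp_lcm_minus_add:
  "pp_lcm s t - s + s = pp_lcm s t" "pp_lcm s t - t + t = pp_lcm s t"
  by (rule poly_mapping_eqI; simp add: lookup_add lookup_minus pp_lcm_def)+

lemma pp_lcm_quotients:
  fixes s t :: "'v::finite pp"
  assumes "a + s = b + t"
  shows "(a + s - pp_lcm s t) + (pp_lcm s t - s) = a" "(a + s - pp_lcm s t) + (pp_lcm s t - t) = b"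
    "(a + s - pp_lcm s t) + pp_lcm s t = a + s"
proof -
  have le: "Poly_Mapping.lookup (pp_lcm s t) x \<le> Poly_Mapping.lookup (a + s) x" for x
  proof -
    have "Poly_Mapping.lookup t x \<le> Poly_Mapping.lookup (a + s) x"
      unfolding assms by (simp add: lookup_add)
    then show ?thesis by (simp add: pp_lcm_def lookup_add)
  qed
  show lcm: "(a + s - pp_lcm s t) + pp_lcm s t = a + s"
  proof (rule poly_mapping_eqI)
    fix x
    show "Poly_Mapping.lookup (a + s - pp_lcm s t + pp_lcm s t) x = Poly_Mapping.lookup (a + s) x"
      using le[of x] by (simp add: lookup_add[of "a + s - pp_lcm s t"] lookup_minus)
  qed
  have "(a + s - pp_lcm s t) + (pp_lcm s t - s) + s = a + s"
    "(a + s - pp_lcm s t) + (pp_lcm s t - t) + t = b + t"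
    using lcm assms by (simp_all add: add.assoc pp_lcm_minus_add)
  then show "(a + s - pp_lcm s t) + (pp_lcm s t - s) = a" "(a + s - pp_lcm s t) + (pp_lcm s t - t) = b"
    by simp_all
qed

definition lcm_term ::
  "('v, 'r) mterm rel \<Rightarrow> ('v::finite, 'r::finite, 'k::field) fvec \<Rightarrow> ('v, 'r, 'k) fvec \<Rightarrow>
   ('v, 'r) mterm"
  where "lcm_term \<sigma> u v =
    (pp_lcm (fst (lead_term \<sigma> u)) (fst (lead_term \<sigma> v)), snd (lead_term \<sigma> u))"

text \<open>
  Two multiples of elements of \<open>G\<close> with the same leading term \<open>T\<close> differ, after normalization, by
  a multiple of an S-vector. So one fixed multiple can stand for all those with leading term \<open>T\<close>.
\<close>

lemma exchange_by_s_vector: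
  fixes g h :: "('v::finite, 'r::finite, 'k::field) fvec"
  assumes T: "T = term_times s (lead_term \<sigma> g)" "T = term_times s' (lead_term \<sigma> h)"
    and nz: "lead_coeff \<sigma> g \<noteq> 0"
  obtains m where "term_times m (lcm_term \<sigma> g h) = T"
    and "Poly_Mapping.single s c *s g =
      Poly_Mapping.single 0 (c * lead_coeff \<sigma> g) *s (Poly_Mapping.single s' (1 / lead_coeff \<sigma> h) *s h)
      + Poly_Mapping.single m (c * lead_coeff \<sigma> g) *s s_vector \<sigma> g h"
proof -
  define l where "l = pp_lcm (fst (lead_term \<sigma> g)) (fst (lead_term \<sigma> h))"
  define m where "m = s + fst (lead_term \<sigma> g) - l"
  have "s + fst (lead_term \<sigma> g) = s' + fst (lead_term \<sigma> h)"
    using T by (simp add: term_times_def prod_eq_iff)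
  note q = pp_lcm_quotients[OF this, folded l_def, folded m_def]
  have "term_times m (lcm_term \<sigma> g h) = T"
    using q(3) T(1) by (simp add: term_times_def lcm_term_def l_def)
  moreover have "s_vector \<sigma> g h =
      Poly_Mapping.single (l - fst (lead_term \<sigma> g)) (1 / lead_coeff \<sigma> g) *s g
      - Poly_Mapping.single (l - fst (lead_term \<sigma> h)) (1 / lead_coeff \<sigma> h) *s h"
    by (simp add: s_vector_def Let_def l_def)
  then have "Poly_Mapping.single m (c * lead_coeff \<sigma> g) *s s_vector \<sigma> g h =
      Poly_Mapping.single s c *s g
      - Poly_Mapping.single s' (c * lead_coeff \<sigma> g * (1 / lead_coeff \<sigma> h)) *s h"
    using nz by (simp add: vector_ssub_ldistrib mult_single q)
  ultimately show thesis by (intro that[of m]) (simp_all add: mult_single)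
qed

section \<open>Buchberger's criterion for arbitrary module orderings\<close>

lemma weight_bound_std_span:
  assumes shift: "\<And>s t. \<omega> (term_times s t) = \<nu> s + \<omega> t"
    and lead: "\<And>g u. g \<in> G \<Longrightarrow> u \<in> mterms g \<Longrightarrow> \<omega> u \<le> (\<omega> (lead_term \<sigma> g) :: real)"
    and v: "v \<in> std_span \<sigma> G {T. \<omega> T \<le> d}" and T: "T \<in> mterms v"
  shows "\<omega> T \<le> d"
  using v T
proof (induction arbitrary: T rule: std_span.induct)
  case zero
  then show ?case by (simp add: mem_mterms)
next
  case (step v g s c)
  from step.prems mterms_add[of "Poly_Mapping.single s c *s g" v] mterms_single_scale[of s c g]
  consider "T \<in> mterms v" | u where "u \<in> mterms g" "T = term_times s u" by blast
  then show ?case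
  proof cases
    case 1
    then show ?thesis by (rule step.IH)
  next
    case 2
    then show ?thesis using lead[OF step.hyps(2) 2(1)] step.hyps(3) by (simp add: shift)
  qed
qed

text \<open>
  For each term \<open>T\<close> with weight in the slab between \<open>D - 1\<close> and \<open>D\<close> that is a multiple of a
  leading term, one monic multiple \<open>h T\<close> with leading term \<open>T\<close> is fixed. By \<open>exchange_by_s_vector\<close>
  the vector \<open>v\<close> is then a linear combination of the \<open>h T\<close> plus a vector with a representation of
  level \<open>D - 1\<close>. All terms of that vector and all further terms of the \<open>h T\<close> lie below the slab,
  by the gap of 1. So the coefficient of \<open>T\<close> in \<open>v\<close> is the one with which \<open>h T\<close> occurs: either
  these coefficients are all zero and the level drops, or \<open>v\<close> has a term in the slab, and all its
  terms there are divisible.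
\<close>

lemma lower_weight_level:
  fixes \<sigma> and G :: "('v::finite, 'r::finite, 'k::field) fvec set" and \<omega> :: "('v, 'r) mterm \<Rightarrow> real"
  defines "divisible T \<equiv> \<exists>g\<in>G. \<exists>s. T = term_times s (lead_term \<sigma> g)"
  assumes shift: "\<And>s t. \<omega> (term_times s t) = \<nu> s + \<omega> t"
    and nz: "\<And>g. g \<in> G \<Longrightarrow> lead_coeff \<sigma> g \<noteq> 0"
    and gap: "\<And>g u. g \<in> G \<Longrightarrow> u \<in> mterms g \<Longrightarrow> u \<noteq> lead_term \<sigma> g \<Longrightarrow> \<omega> u + 1 \<le> \<omega> (lead_term \<sigma> g)"
    and S: "\<And>g h. g \<in> G \<Longrightarrow> h \<in> G \<Longrightarrow> snd (lead_term \<sigma> g) = snd (lead_term \<sigma> h) \<Longrightarrow>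
      s_vector \<sigma> g h \<in> std_span \<sigma> G {T. \<omega> T + 1 \<le> \<omega> (lcm_term \<sigma> g h)}"
    and v: "v \<in> std_span \<sigma> G {T. \<omega> T \<le> D}"
  shows "v \<in> std_span \<sigma> G {T. \<omega> T \<le> D - 1} \<or>
    (\<exists>T\<in>mterms v. D - 1 < \<omega> T) \<and> (\<forall>T\<in>mterms v. D - 1 < \<omega> T \<longrightarrow> divisible T)"
proof -
  obtain A where A: "finite A" "A \<subseteq> {T. \<omega> T \<le> D}" "v \<in> std_span \<sigma> G A"
    using std_span_finite[OF v] by blast
  define B where "B = {T \<in> A. D - 1 < \<omega> T \<and> divisible T}"
  have "finite B" using A(1) by (simp add: B_def)
  have "\<forall>T. \<exists>gs. divisible T \<longrightarrow> fst gs \<in> G \<and> T = term_times (snd gs) (lead_term \<sigma> (fst gs))"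
    by (auto simp: divisible_def)
  then obtain gs where gs: "\<And>T. divisible T \<Longrightarrow> fst (gs T) \<in> G"
      "\<And>T. divisible T \<Longrightarrow> term_times (snd (gs T)) (lead_term \<sigma> (fst (gs T))) = T"
    by metis
  define h where "h T =
      Poly_Mapping.single (snd (gs T)) (1 / lead_coeff \<sigma> (fst (gs T))) *s fst (gs T)" for T
  have h_lead: "mcoeff (h T) T = 1" if "divisible T" for T
    using mcoeff_single_scale[of "snd (gs T)" "1 / lead_coeff \<sigma> (fst (gs T))" "fst (gs T)"
        "lead_term \<sigma> (fst (gs T))"] gs[OF that] nz[of "fst (gs T)"]
    by (simp add: h_def lead_coeff_def)
  have h_tail: "\<omega> U + 1 \<le> \<omega> T" if T: "divisible T" and U: "U \<in> mterms (h T)" "U \<noteq> T" for T U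
  proof -
    obtain u where "u \<in> mterms (fst (gs T))" "U = term_times (snd (gs T)) u"
      using U(1) mterms_single_scale unfolding h_def by blast
    then show ?thesis using gap[of "fst (gs T)" u] gs[OF T] U(2)
      by (metis shift add.assoc add_left_mono)
  qed
  \<comment> \<open>Summand by summand: one inside the slab is exchanged for a multiple of the fixed \<open>h T\<close>.\<close>
  have "\<exists>v'\<in>std_span \<sigma> G {T. \<omega> T \<le> D - 1}. \<exists>c. v = v' + (\<Sum>T\<in>B. Poly_Mapping.single 0 (c T) *s h T)"
    using A(3)
  proof (induction rule: std_span.induct)
    case zero
    show ?case by (intro bexI[of _ 0] exI[of _ "\<lambda>_. 0"] std_span.zero) simp
  next
    case (step v g s a)
    define T where "T = term_times s (lead_term \<sigma> g)"
    from step.IH obtain v' c where v': "v' \<in> std_span \<sigma> G {T. \<omega> T \<le> D - 1}"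
        "v = v' + (\<Sum>T\<in>B. Poly_Mapping.single 0 (c T) *s h T)" by blast
    show ?case
    proof (cases "\<omega> T \<le> D - 1")
      case True
      then have "Poly_Mapping.single s a *s g + v' \<in> std_span \<sigma> G {T. \<omega> T \<le> D - 1}"
        using v'(1) step.hyps(2) by (intro std_span.step) (simp_all add: T_def)
      then show ?thesis using v'(2) by (intro bexI exI[of _ c]) (simp_all add: add.assoc)
    next
      case False
      have div: "divisible T" using step.hyps(2) by (auto simp: divisible_def T_def)
      have "T \<in> B" using False step.hyps(3) div by (simp add: B_def T_def)
      obtain m where m: "term_times m (lcm_term \<sigma> g (fst (gs T))) = T"
          "Poly_Mapping.single s a *s g = Poly_Mapping.single 0 (a * lead_coeff \<sigma> g) *s h T
            + Poly_Mapping.single m (a * lead_coeff \<sigma> g) *s s_vector \<sigma> g (fst (gs T))"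
        using exchange_by_s_vector[OF T_def gs(2)[OF div, symmetric] nz[OF step.hyps(2)]]
        unfolding h_def by metis
      define r where "r = Poly_Mapping.single m (a * lead_coeff \<sigma> g) *s s_vector \<sigma> g (fst (gs T))"
      have "snd (lead_term \<sigma> g) = snd (lead_term \<sigma> (fst (gs T)))"
        using T_def gs(2)[OF div] by (metis term_times_def snd_conv)
      from std_span_scale[OF S[OF step.hyps(2) gs(1)[OF div] this]]
      have "r \<in> std_span \<sigma> G (term_times m ` {U. \<omega> U + 1 \<le> \<omega> (lcm_term \<sigma> g (fst (gs T)))})"
        by (simp add: r_def)
      moreover have "\<omega> T \<le> D" using A(2) step.hyps(3) by (auto simp: T_def)
      then have "term_times m ` {U. \<omega> U + 1 \<le> \<omega> (lcm_term \<sigma> g (fst (gs T)))} \<subseteq> {U. \<omega> U \<le> D - 1}"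
        using m(1) shift[of m "lcm_term \<sigma> g (fst (gs T))"] by (auto simp: shift)
      ultimately have r: "r \<in> std_span \<sigma> G {T. \<omega> T \<le> D - 1}" by (rule std_span_mono[OF _ order_refl])
      define c' where "c' U = c U + (if U = T then a * lead_coeff \<sigma> g else 0)" for U
      have "(\<Sum>U\<in>B. Poly_Mapping.single 0 (c' U) *s h U) = (\<Sum>U\<in>B. Poly_Mapping.single 0 (c U) *s h U
          + (if U = T then Poly_Mapping.single 0 (a * lead_coeff \<sigma> g) *s h U else 0))"
        by (intro sum.cong) (auto simp: c'_def single_add vector_sadd_rdistrib)
      also have "\<dots> = (\<Sum>U\<in>B. Poly_Mapping.single 0 (c U) *s h U)
          + Poly_Mapping.single 0 (a * lead_coeff \<sigma> g) *s h T"
        using \<open>finite B\<close> \<open>T \<in> B\<close> by (simp add: sum.distrib sum.delta)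
      finally have "Poly_Mapping.single s a *s g + v
          = (r + v') + (\<Sum>U\<in>B. Poly_Mapping.single 0 (c' U) *s h U)"
        using m(2) v'(2) by (simp add: r_def)
      then show ?thesis using std_span_add[OF r v'(1)] by blast
    qed
  qed
  then obtain v' c where v': "v' \<in> std_span \<sigma> G {T. \<omega> T \<le> D - 1}"
      "v = v' + (\<Sum>T\<in>B. Poly_Mapping.single 0 (c T) *s h T)" by blast
  have h_coeff: "mcoeff (Poly_Mapping.single 0 (c U) *s h U) T = (if U = T then c U else 0)"
    if "U \<in> B" "D - 1 < \<omega> T" for U T
  proof -
    have "mcoeff (Poly_Mapping.single 0 (c U) *s h U) T = c U * mcoeff (h U) T"
      using mcoeff_single_scale[of 0 "c U" "h U" T] by (simp add: term_times_def)
    moreover have "mcoeff (h U) T = 0" if "U \<noteq> T"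
    proof (rule ccontr)
      assume "mcoeff (h U) T \<noteq> 0"
      then have "\<omega> T + 1 \<le> \<omega> U" using h_tail[of U T] \<open>U \<in> B\<close> \<open>U \<noteq> T\<close>
        by (auto simp: mem_mterms B_def)
      moreover have "\<omega> U \<le> D" using \<open>U \<in> B\<close> A(2) by (auto simp: B_def)
      ultimately show False using \<open>D - 1 < \<omega> T\<close> by simp
    qed
    ultimately show ?thesis using h_lead[of U] \<open>U \<in> B\<close> by (auto simp: B_def)
  qed
  have coeff: "mcoeff v T = (if T \<in> B then c T else 0)" if T: "D - 1 < \<omega> T" for T
  proof -
    have "mcoeff v' T = 0"
    proof (rule ccontr)
      assume "mcoeff v' T \<noteq> 0"
      moreover have "\<omega> u \<le> \<omega> (lead_term \<sigma> g)" if "g \<in> G" "u \<in> mterms g" for g u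
        using gap[OF that] by (cases "u = lead_term \<sigma> g") auto
      ultimately have "\<omega> T \<le> D - 1"
        using weight_bound_std_span[of \<omega> \<nu> G \<sigma> v' "D - 1" T] shift v'(1) by (simp add: mem_mterms)
      with T show False by simp
    qed
    then have "mcoeff v T = (\<Sum>U\<in>B. if U = T then c U else 0)"
      using h_coeff T by (simp add: v'(2) mcoeff_sum)
    then show ?thesis using \<open>finite B\<close> by (simp add: sum.delta)
  qed
  show ?thesis
  proof (cases "\<forall>T\<in>B. c T = 0")
    case True
    then have "v = v'" by (simp add: v'(2))
    then show ?thesis using v'(1) by simp
  next
    case False
    then obtain T where "T \<in> B" "c T \<noteq> 0" by blast
    then have "T \<in> mterms v" "D - 1 < \<omega> T" using coeff[of T] by (auto simp: mem_mterms B_def)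
    moreover have "divisible T" if "T \<in> mterms v" "D - 1 < \<omega> T" for T
      using that coeff[of T] by (auto simp: mem_mterms B_def split: if_splits)
    ultimately show ?thesis by blast
  qed
qed

text \<open>
  The weights are chosen for \<open>f\<close> as well as for \<open>G\<close>, so \<open>LT(f)\<close> has the largest weight among the
  terms of \<open>f\<close>. This weight bounds the level of every representation of \<open>f\<close> from below.
\<close>

theorem buchberger_criterion:
  fixes G :: "('v::finite, 'r::finite, 'k::field) fvec set"
  assumes \<sigma>: "module_ordering \<sigma>" and G: "finite G" "0 \<notin> G"
    and S: "\<And>g h. g \<in> G \<Longrightarrow> h \<in> G \<Longrightarrow> snd (lead_term \<sigma> g) = snd (lead_term \<sigma> h) \<Longrightarrow>
      s_vector \<sigma> g h \<in> std_span \<sigma> G {T. (T, lcm_term \<sigma> g h) \<in> \<sigma>}"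
    and f: "f \<in> module.span (*s) G" "f \<noteq> 0"
  shows "\<exists>g\<in>G. \<exists>s. lead_term \<sigma> f = term_times s (lead_term \<sigma> g)"
proof -
  define L where "L = {(g, h) \<in> G \<times> G. snd (lead_term \<sigma> g) = snd (lead_term \<sigma> h)}"
  have "\<forall>p. \<exists>A. p \<in> L \<longrightarrow> finite A \<and> A \<subseteq> {T. (T, lcm_term \<sigma> (fst p) (snd p)) \<in> \<sigma>}
      \<and> s_vector \<sigma> (fst p) (snd p) \<in> std_span \<sigma> G A"
  proof
    fix p
    show "\<exists>A. p \<in> L \<longrightarrow> finite A \<and> A \<subseteq> {T. (T, lcm_term \<sigma> (fst p) (snd p)) \<in> \<sigma>}
      \<and> s_vector \<sigma> (fst p) (snd p) \<in> std_span \<sigma> G A"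
    proof (cases "p \<in> L")
      case True
      then have "s_vector \<sigma> (fst p) (snd p) \<in> std_span \<sigma> G {T. (T, lcm_term \<sigma> (fst p) (snd p)) \<in> \<sigma>}"
        using S by (auto simp: L_def)
      from std_span_finite[OF this] show ?thesis by metis
    qed simp
  qed
  then obtain A where A: "\<And>p. p \<in> L \<Longrightarrow> finite (A p)"
      "\<And>p. p \<in> L \<Longrightarrow> A p \<subseteq> {T. (T, lcm_term \<sigma> (fst p) (snd p)) \<in> \<sigma>}"
      "\<And>p. p \<in> L \<Longrightarrow> s_vector \<sigma> (fst p) (snd p) \<in> std_span \<sigma> G (A p)" by metis
  \<comment> \<open>All comparisons on which the descent relies.\<close>
  define E where "E = (\<Union>g\<in>insert f G. (\<lambda>u. (u, lead_term \<sigma> g)) ` (mterms g - {lead_term \<sigma> g}))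
    \<union> (\<Union>p\<in>L. (\<lambda>T. (T, lcm_term \<sigma> (fst p) (snd p))) ` A p)"
  have "finite L" using G(1) by (auto simp: L_def intro: finite_subset[of _ "G \<times> G"])
  then have "finite E" using G(1) A(1) by (simp add: E_def)
  moreover have "E \<subseteq> \<sigma>"
  proof -
    have "(u, lead_term \<sigma> g) \<in> \<sigma>" if "g \<in> insert f G" "u \<in> mterms g" "u \<noteq> lead_term \<sigma> g" for g u
    proof (rule lead_term_greatest(2)[OF \<sigma> _ that(2,3)])
      show "g \<noteq> 0" using that(1) G(2) f(2) by blast
    qed
    moreover have "(T, lcm_term \<sigma> (fst p) (snd p)) \<in> \<sigma>" if "p \<in> L" "T \<in> A p" for p T
      using A(2) that by blast
    ultimately show ?thesis unfolding E_def by (intro Un_least UN_least image_subsetI) simp_all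
  qed
  ultimately have "\<exists>w \<beta>. \<forall>u t. (u, t) \<in> E \<longrightarrow> term_weight w \<beta> u + 1 \<le> term_weight w \<beta> t"
    by (rule weights_for_module_ordering[OF \<sigma>])
  then obtain w \<beta> where "\<forall>u t. (u, t) \<in> E \<longrightarrow> term_weight w \<beta> u + 1 \<le> term_weight w \<beta> t" by blast
  then have E: "term_weight w \<beta> u + 1 \<le> term_weight w \<beta> t" if "(u, t) \<in> E" for u t using that by blast
  define \<omega> where "\<omega> = term_weight w \<beta>"
  have shift: "\<omega> (term_times s t) = pp_weight w s + \<omega> t" for s and t :: "('v, 'r) mterm"
    by (simp add: \<omega>_def term_weight_term_times)
  have gap: "\<omega> u + 1 \<le> \<omega> (lead_term \<sigma> g)"
    if "g \<in> insert f G" "u \<in> mterms g" "u \<noteq> lead_term \<sigma> g" for g u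
  proof -
    have "(u, lead_term \<sigma> g) \<in> E"
      unfolding E_def using that by (intro UnI1 UN_I[of g] rev_image_eqI[of u]) simp_all
    then show ?thesis unfolding \<omega>_def by (rule E)
  qed
  have S': "s_vector \<sigma> g h \<in> std_span \<sigma> G {T. \<omega> T + 1 \<le> \<omega> (lcm_term \<sigma> g h)}"
    if "g \<in> G" "h \<in> G" "snd (lead_term \<sigma> g) = snd (lead_term \<sigma> h)" for g h
  proof -
    have L: "(g, h) \<in> L" using that by (simp add: L_def)
    have "\<omega> T + 1 \<le> \<omega> (lcm_term \<sigma> g h)" if "T \<in> A (g, h)" for T
    proof -
      have "(T, lcm_term \<sigma> g h) \<in> E"
        unfolding E_def using that L by (intro UnI2 UN_I[of "(g, h)"] rev_image_eqI[of T]) simp_all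
      then show ?thesis unfolding \<omega>_def by (rule E)
    qed
    then have "A (g, h) \<subseteq> {T. \<omega> T + 1 \<le> \<omega> (lcm_term \<sigma> g h)}" by blast
    then show ?thesis using std_span_mono[OF A(3)[OF L] order_refl] by simp
  qed
  have level: "f \<in> std_span \<sigma> G {T. \<omega> T \<le> D - 1} \<or>
      (\<exists>g\<in>G. \<exists>s. lead_term \<sigma> f = term_times s (lead_term \<sigma> g))"
    if "f \<in> std_span \<sigma> G {T. \<omega> T \<le> D}" for D
  proof -
    have "f \<in> std_span \<sigma> G {T. \<omega> T \<le> D - 1} \<or> (\<exists>T\<in>mterms f. D - 1 < \<omega> T) \<and>
      (\<forall>T\<in>mterms f. D - 1 < \<omega> T \<longrightarrow> (\<exists>g\<in>G. \<exists>s. T = term_times s (lead_term \<sigma> g)))"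
    proof (rule lower_weight_level[where \<omega> = \<omega> and \<nu> = "pp_weight w"])
      show "\<omega> (term_times s t) = pp_weight w s + \<omega> t" for s t by (rule shift)
      show "s_vector \<sigma> g h \<in> std_span \<sigma> G {T. \<omega> T + 1 \<le> \<omega> (lcm_term \<sigma> g h)}"
        if "g \<in> G" "h \<in> G" "snd (lead_term \<sigma> g) = snd (lead_term \<sigma> h)" for g h
        using that by (rule S')
      show "f \<in> std_span \<sigma> G {T. \<omega> T \<le> D}" by (rule that)
      show "lead_coeff \<sigma> g \<noteq> 0" if "g \<in> G" for g
        by (rule lead_coeff_nonzero[OF \<sigma>]) (use that G(2) in metis)
      show "\<omega> u + 1 \<le> \<omega> (lead_term \<sigma> g)" if "g \<in> G" "u \<in> mterms g" "u \<noteq> lead_term \<sigma> g" for g u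
        by (rule gap) (use that in simp_all)
    qed
    then show ?thesis
    proof (elim disjE conjE bexE)
      fix T
      assume T: "T \<in> mterms f" "D - 1 < \<omega> T"
        and all: "\<forall>T\<in>mterms f. D - 1 < \<omega> T \<longrightarrow> (\<exists>g\<in>G. \<exists>s. T = term_times s (lead_term \<sigma> g))"
      have "\<omega> T \<le> \<omega> (lead_term \<sigma> f)" using gap[of f T] T(1) by (cases "T = lead_term \<sigma> f") auto
      then have "D - 1 < \<omega> (lead_term \<sigma> f)" using T(2) by simp
      then show ?thesis using bspec[OF all lead_term_greatest(1)[OF \<sigma> f(2)]] by simp
    qed (rule disjI1)
  qed
  \<comment> \<open>The level drops by 1 as long as \<open>LT(f)\<close> is not found divisible, so \<open>n\<close> further rounds suffice.\<close>
  have descend: "\<exists>g\<in>G. \<exists>s. lead_term \<sigma> f = term_times s (lead_term \<sigma> g)"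
    if "f \<in> std_span \<sigma> G {T. \<omega> T \<le> D}" "D \<le> \<omega> (lead_term \<sigma> f) + real n" for D n
    using that
  proof (induction n arbitrary: D)
    case 0
    have "f \<notin> std_span \<sigma> G {T. \<omega> T \<le> D - 1}"
    proof
      assume low: "f \<in> std_span \<sigma> G {T. \<omega> T \<le> D - 1}"
      have "\<omega> (lead_term \<sigma> f) \<le> D - 1"
      proof (rule weight_bound_std_span[where \<omega> = \<omega> and \<nu> = "pp_weight w", OF shift])
        show "\<omega> u \<le> \<omega> (lead_term \<sigma> g)" if "g \<in> G" "u \<in> mterms g" for g u
          using gap[of g u] that by (cases "u = lead_term \<sigma> g") auto
        show "f \<in> std_span \<sigma> G {T. \<omega> T \<le> D - 1}" by (rule low)
        show "lead_term \<sigma> f \<in> mterms f" by (rule lead_term_greatest(1)[OF \<sigma> f(2)])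
      qed
      with 0(2) show False by simp
    qed
    then show ?case using level[OF 0(1)] by blast
  next
    case (Suc n)
    then have "D - 1 \<le> \<omega> (lead_term \<sigma> f) + real n" by simp
    then show ?case using level[OF Suc.prems(1)] Suc.IH[of "D - 1"] by blast
  qed
  have "f \<in> std_span \<sigma> G UNIV" using f(1) span_subset_std_span by blast
  then obtain B where B: "finite B" "f \<in> std_span \<sigma> G B" by (rule std_span_finite)
  define D where "D = Max (insert 0 (\<omega> ` B))"
  have "\<omega> T \<le> D" if "T \<in> B" for T using B(1) that unfolding D_def by (intro Max_ge) auto
  then have "B \<subseteq> {T. \<omega> T \<le> D}" by blast
  with B(2) have "f \<in> std_span \<sigma> G {T. \<omega> T \<le> D}" by (rule std_span_mono[OF _ order_refl])
  moreover obtain n where "D - \<omega> (lead_term \<sigma> f) \<le> real n" using real_arch_simple by blast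
  ultimately show ?thesis by (intro descend[of D n]) simp_all
qed

section \<open>Dehomogenization of homogeneous vectors\<close>

lemma deh_pp_add: "deh_pp (s + t) = deh_pp s + deh_pp t"
  by (rule poly_mapping_eqI) (simp add: lookup_add)

lemma deh_pp_diff: "deh_pp (s - t) = deh_pp s - deh_pp t"
  by (rule poly_mapping_eqI) (simp add: lookup_minus)

lemma deh_pp_lcm: "deh_pp (pp_lcm s t) = pp_lcm (deh_pp s) (deh_pp t)"
  by (rule poly_mapping_eqI) (simp add: pp_lcm_def)

lemma deh_pp_y_times: "deh_pp (y_times a t) = t"
  by (rule poly_mapping_eqI) (simp add: y_times_def)

lemma deh_term_term_times: "deh_term (term_times s t) = term_times (deh_pp s) (deh_term t)"
  by (simp add: deh_term_def term_times_def deh_pp_add)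

definition deh_pol :: "('m + 'n, 'k::comm_monoid_add) mpol \<Rightarrow> ('n, 'k) mpol"
  where "deh_pol p =
    (\<Sum>t\<in>Poly_Mapping.keys p. Poly_Mapping.single (deh_pp t) (Poly_Mapping.lookup p t))"

lemma deh_nth: "deh V $ i = deh_pol (V $ i)"
  by (simp add: deh_def deh_pol_def)

lemma deh_pol_superset:
  assumes "finite S" "Poly_Mapping.keys p \<subseteq> S"
  shows "deh_pol p = (\<Sum>t\<in>S. Poly_Mapping.single (deh_pp t) (Poly_Mapping.lookup p t))"
  unfolding deh_pol_def using assms
  by (intro sum.mono_neutral_left) (auto simp: in_keys_iff)

lemma deh_pol_add: "deh_pol (p + q) = deh_pol p + deh_pol q"
proof -
  let ?S = "Poly_Mapping.keys p \<union> Poly_Mapping.keys q"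
  have "deh_pol (p + q) = (\<Sum>t\<in>?S. Poly_Mapping.single (deh_pp t) (Poly_Mapping.lookup (p + q) t))"
    by (intro deh_pol_superset keys_add) simp
  also have "\<dots> = deh_pol p + deh_pol q"
    using deh_pol_superset[of ?S p] deh_pol_superset[of ?S q]
    by (simp add: lookup_add single_add sum.distrib)
  finally show ?thesis .
qed

lemma deh_pol_zero [simp]: "deh_pol 0 = 0"
  by (simp add: deh_pol_def)

lemma deh_pol_single [simp]: "deh_pol (Poly_Mapping.single t c) = Poly_Mapping.single (deh_pp t) c"
  by (simp add: deh_pol_def)

lemma deh_pol_sum: "deh_pol (sum f X) = (\<Sum>x\<in>X. deh_pol (f x))"
  by (induction X rule: infinite_finite_induct) (simp_all add: deh_pol_add)

lemma deh_pol_single_times: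
  fixes p :: "('m + 'n, 'k::field) mpol"
  shows "deh_pol (Poly_Mapping.single s c * p) = Poly_Mapping.single (deh_pp s) c * deh_pol p"
proof -
  have "Poly_Mapping.single s c * p
      = (\<Sum>t\<in>Poly_Mapping.keys p. Poly_Mapping.single (s + t) (c * Poly_Mapping.lookup p t))"
    by (subst (1) poly_mapping_sum_singles[of p]) (simp add: sum_distrib_left mult_single)
  then show ?thesis
    by (simp add: deh_pol_sum) (simp add: deh_pol_def sum_distrib_left mult_single deh_pp_add)
qed

lemma deh_zero [simp]: "deh 0 = 0"
  by (simp add: vec_eq_iff deh_nth)

lemma deh_add: "deh (U + V) = deh U + deh V"
  by (simp add: vec_eq_iff deh_nth deh_pol_add)

lemma deh_diff: "deh (U - V) = deh U - deh V"
  for U V :: "('m + 'n, 'r::finite, 'k::field) fvec"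
  using deh_add[of "U - V" V] by (simp add: eq_diff_eq)

lemma deh_single_scale:
  fixes V :: "('m + 'n, 'r::finite, 'k::field) fvec"
  shows "deh (Poly_Mapping.single s c *s V) = Poly_Mapping.single (deh_pp s) c *s deh V"
  by (simp add: vec_eq_iff deh_nth deh_pol_single_times)

lemma deh_hom: "deh (hom W \<delta> v) = v"
  by (simp add: vec_eq_iff deh_nth hom_def deh_pol_sum deh_pp_y_times flip: poly_mapping_sum_singles)

lemma pp_deg_add: "pp_deg A (s + t) = pp_deg A s + pp_deg A t"
  by (simp add: pp_deg_def vec_eq_iff matrix_vector_mult_def lookup_add distrib_left sum.distrib)

lemma term_deg_term_times: "term_deg A \<delta> (term_times s t) = pp_deg A s + term_deg A \<delta> t"
  by (simp add: term_deg_def term_times_def pp_deg_add)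

lemma pp_deg_Wbar:
  "pp_deg (Wbar W) t $ k = int (Poly_Mapping.lookup t (Inl k)) + pp_deg W (deh_pp t) $ k"
proof -
  have "(\<Sum>l\<in>UNIV. mat 1 $ k $ l * int (Poly_Mapping.lookup t (Inl l)))
      = int (Poly_Mapping.lookup t (Inl k))"
    by (simp add: mat_def if_distrib[of "\<lambda>x. x * _"] cong: if_cong)
  then show ?thesis
    by (simp add: pp_deg_def matrix_vector_mult_def Wbar_def sum.Plus flip: UNIV_Plus_UNIV)
qed

lemma term_deg_Wbar:
  "term_deg (Wbar W) \<delta> t $ k
    = int (Poly_Mapping.lookup (fst t) (Inl k)) + term_deg W \<delta> (deh_term t) $ k"
  by (simp add: term_deg_def deh_term_def pp_deg_Wbar)

text \<open>
  The indeterminate \<open>y\<^sub>k\<close> has degree the \<open>k\<close>-th unit vector, so its exponent can be read off from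
  the degree once the exponents of the \<open>x\<^sub>j\<close> are known.
\<close>

lemma term_eqI_deg_deh:
  assumes "term_deg (Wbar W) \<delta> u = term_deg (Wbar W) \<delta> t" "deh_term u = deh_term t"
  shows "u = t"
proof (rule prod_eqI)
  show "fst u = fst t"
  proof (rule poly_mapping_eqI)
    fix x
    show "Poly_Mapping.lookup (fst u) x = Poly_Mapping.lookup (fst t) x"
    proof (cases x)
      case (Inl k)
      then show ?thesis
        using term_deg_Wbar[of W \<delta> u k] term_deg_Wbar[of W \<delta> t k] assms by simp
    next
      case (Inr j)
      then show ?thesis using assms(2) by (metis deh_term_def fst_conv lookup_deh_pp)
    qed
  qed
  show "snd u = snd t" using assms(2) by (simp add: deh_term_def)
qed

lemma homogeneousD:
  assumes "homogeneous W \<delta> U" "u \<in> mterms U" "t \<in> mterms U"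
  shows "term_deg (Wbar W) \<delta> u = term_deg (Wbar W) \<delta> t"
  using assms by (auto simp: homogeneous_def)

lemma homogeneous_hom: "homogeneous W \<delta> (hom W \<delta> v)"
  unfolding homogeneous_def
proof (intro exI ballI)
  fix T
  assume "T \<in> mterms (hom W \<delta> v)"
  then obtain t i where T: "T = (t, i)" "t \<in> Poly_Mapping.keys (hom W \<delta> v $ i)"
    by (auto simp: mterms_def)
  then obtain u where u: "u \<in> Poly_Mapping.keys (v $ i)"
      "t = y_times (top_deg W \<delta> v - term_deg W \<delta> (u, i)) u"
    using keys_sum unfolding hom_def by (fastforce split: if_splits)
  show "term_deg (Wbar W) \<delta> T = top_deg W \<delta> v"
  proof (rule vec_eq_iff[THEN iffD2], rule allI)
    fix k
    have "term_deg W \<delta> (u, i) $ k \<le> top_deg W \<delta> v $ k"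
      using u(1) by (auto simp: top_deg_def mterms_def finite_mterms[unfolded mterms_def]
          intro!: Max_ge)
    moreover have "deh_term T = (u, i)" by (simp add: T(1) u(2) deh_term_def deh_pp_y_times)
    ultimately show "term_deg (Wbar W) \<delta> T $ k = top_deg W \<delta> v $ k"
      by (simp add: term_deg_Wbar) (simp add: T(1) u(2) y_times_def)
  qed
qed

text \<open>
  No two terms of a homogeneous vector are merged by setting the \<open>y\<^sub>k\<close> to 1, so nothing cancels.
\<close>

lemma mcoeff_deh:
  assumes U: "homogeneous W \<delta> U" and t: "t \<in> mterms U"
  shows "mcoeff (deh U) (deh_term t) = mcoeff U t"
proof -
  obtain s i where s: "t = (s, i)" by (cases t)
  have inj: "u = s" if "u \<in> Poly_Mapping.keys (U $ i)" "deh_pp u = deh_pp s" for u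
    using term_eqI_deg_deh[of W \<delta> "(u, i)" t] homogeneousD[OF U, of "(u, i)" t] t that s
    by (simp add: mterms_def deh_term_def)
  have "mcoeff (deh U) (deh_term t)
      = (\<Sum>u\<in>Poly_Mapping.keys (U $ i).
          if deh_pp u = deh_pp s then Poly_Mapping.lookup (U $ i) u else 0)"
    by (simp add: s mcoeff_def deh_term_def deh_nth deh_pol_def lookup_sum lookup_single when_def)
  also have "\<dots> = (\<Sum>u\<in>Poly_Mapping.keys (U $ i). if u = s then Poly_Mapping.lookup (U $ i) u else 0)"
    using inj by (intro sum.cong) auto
  finally have "mcoeff (deh U) (deh_term t)
      = (\<Sum>u\<in>Poly_Mapping.keys (U $ i). if u = s then Poly_Mapping.lookup (U $ i) u else 0)" .
  then show ?thesis using t by (simp add: s sum.delta mterms_def mcoeff_def)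
qed

lemma mterms_deh_subset: "mterms (deh U) \<subseteq> deh_term ` mterms U"
proof clarify
  fix s i
  assume "(s, i) \<in> mterms (deh U)"
  then obtain t where "t \<in> Poly_Mapping.keys (U $ i)" "s = deh_pp t"
    using keys_sum by (fastforce simp: mterms_def deh_def split: if_splits)
  then show "(s, i) \<in> deh_term ` mterms U"
    by (auto simp: mterms_def deh_term_def intro!: image_eqI[of _ _ "(t, i)"])
qed

lemma mterms_deh:
  assumes "homogeneous W \<delta> U"
  shows "mterms (deh U) = deh_term ` mterms U"
  using mcoeff_deh[OF assms] mterms_deh_subset by (fastforce simp: mem_mterms)

lemma deh_eq_zero_iff:
  assumes "homogeneous W \<delta> U"
  shows "deh U = 0 \<longleftrightarrow> U = 0"
  using mterms_deh[OF assms] by (metis image_is_empty mterms_eq_empty_iff)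

text \<open>
  All terms of \<open>U\<close> have the same degree, so the extended ordering decides between them by \<open>\<sigma>\<close>.
\<close>

lemma lead_term_deh:
  assumes \<sigma>: "module_ordering \<sigma>" and U: "homogeneous W \<delta> U" "U \<noteq> 0"
  shows "lead_term (extension W \<delta> \<sigma>) U \<in> mterms U"
    and "lead_term \<sigma> (deh U) = deh_term (lead_term (extension W \<delta> \<sigma>) U)"
    and "lead_coeff \<sigma> (deh U) = lead_coeff (extension W \<delta> \<sigma>) U"
proof -
  have nz: "deh U \<noteq> 0" using deh_eq_zero_iff[OF U(1)] U(2) by simp
  obtain t where t: "t \<in> mterms U" "lead_term \<sigma> (deh U) = deh_term t"
    using lead_term_greatest(1)[OF \<sigma> nz] unfolding mterms_deh[OF U(1)] by blast
  have ext: "(u, u') \<in> extension W \<delta> \<sigma> \<longleftrightarrow> (deh_term u, deh_term u') \<in> \<sigma>"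
    if "u \<in> mterms U" "u' \<in> mterms U" for u u'
    using homogeneousD[OF U(1) that] by (simp add: extension_def lex_less_def)
  have below: "(deh_term u, deh_term t) \<in> \<sigma>" if "u \<in> mterms U" "u \<noteq> t" for u
  proof -
    have "deh_term u \<noteq> deh_term t"
      using term_eqI_deg_deh[OF homogeneousD[OF U(1) that(1) t(1)]] that(2) by blast
    then show ?thesis
      using lead_term_greatest(2)[OF \<sigma> nz, of "deh_term u"] t(2) that(1) mterms_deh[OF U(1)] by simp
  qed
  have *: "lead_term (extension W \<delta> \<sigma>) U = t"
  proof (rule lead_term_eqI[OF t(1)])
    fix u
    assume u: "u \<in> mterms U" "u \<noteq> t"
    show "(u, t) \<in> extension W \<delta> \<sigma>" using below[OF u] ext[OF u(1) t(1)] by simp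
    show "(t, u) \<notin> extension W \<delta> \<sigma>"
      using below[OF u] ext[OF t(1) u(1)] module_orderingD(1,2)[OF \<sigma>] by blast
  qed
  show "lead_term (extension W \<delta> \<sigma>) U \<in> mterms U"
    and "lead_term \<sigma> (deh U) = deh_term (lead_term (extension W \<delta> \<sigma>) U)"
    and "lead_coeff \<sigma> (deh U) = lead_coeff (extension W \<delta> \<sigma>) U"
    unfolding * lead_coeff_def t(2) by (rule t(1) refl mcoeff_deh[OF U(1) t(1)])+
qed

lemma homogeneous_diff:
  fixes U V :: "('m::finite + 'n::finite, 'r::finite, 'k::field) fvec"
  assumes "\<And>t. t \<in> mterms U \<Longrightarrow> term_deg (Wbar W) \<delta> t = d"
    and "\<And>t. t \<in> mterms V \<Longrightarrow> term_deg (Wbar W) \<delta> t = d"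
  shows "homogeneous W \<delta> (U - V)"
  unfolding homogeneous_def
proof (intro exI ballI)
  fix t
  assume "t \<in> mterms (U - V)"
  then consider "t \<in> mterms U" | "t \<in> mterms V" using mterms_diff by blast
  then show "term_deg (Wbar W) \<delta> t = d" by cases (simp_all add: assms)
qed

lemma term_deg_single_scale:
  fixes V :: "('m::finite + 'n::finite, 'r::finite, 'k::field) fvec"
  assumes V: "homogeneous W \<delta> V" "v \<in> mterms V" and t: "t \<in> mterms (Poly_Mapping.single s c *s V)"
  shows "term_deg (Wbar W) \<delta> t = term_deg (Wbar W) \<delta> (term_times s v)"
proof -
  obtain u where "u \<in> mterms V" "t = term_times s u" using t mterms_single_scale by blast
  then show ?thesis using homogeneousD[OF V(1) _ V(2)] by (simp add: term_deg_term_times)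
qed

lemma homogeneous_s_vector:
  assumes \<sigma>: "module_ordering \<sigma>" and U: "homogeneous W \<delta> U" "U \<noteq> 0"
    and V: "homogeneous W \<delta> V" "V \<noteq> 0"
    and comp: "snd (lead_term (extension W \<delta> \<sigma>) U) = snd (lead_term (extension W \<delta> \<sigma>) V)"
  shows "homogeneous W \<delta> (s_vector (extension W \<delta> \<sigma>) U V)"
proof -
  let ?u = "lead_term (extension W \<delta> \<sigma>) U" and ?v = "lead_term (extension W \<delta> \<sigma>) V"
  define l where "l = pp_lcm (fst ?u) (fst ?v)"
  have "l - fst ?u + fst ?u = l" "l - fst ?v + fst ?v = l"
    unfolding l_def by (rule pp_lcm_minus_add)+
  then have l: "term_times (l - fst ?u) ?u = (l, snd ?u)" "term_times (l - fst ?v) ?v = (l, snd ?u)"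
    using comp by (simp_all add: term_times_def)
  show ?thesis
    unfolding s_vector_def Let_def l_def[symmetric]
  proof (rule homogeneous_diff)
    show "term_deg (Wbar W) \<delta> t = term_deg (Wbar W) \<delta> (l, snd ?u)"
      if "t \<in> mterms (Poly_Mapping.single (l - fst ?u) c *s U)" for t c
      using term_deg_single_scale[OF U(1) lead_term_deh(1)[OF \<sigma> U] that] unfolding l .
    show "term_deg (Wbar W) \<delta> t = term_deg (Wbar W) \<delta> (l, snd ?u)"
      if "t \<in> mterms (Poly_Mapping.single (l - fst ?v) c *s V)" for t c
      using term_deg_single_scale[OF V(1) lead_term_deh(1)[OF \<sigma> V] that] unfolding l .
  qed
qed

lemma deh_s_vector:
  assumes \<sigma>: "module_ordering \<sigma>" and U: "homogeneous W \<delta> U" "U \<noteq> 0"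
    and V: "homogeneous W \<delta> V" "V \<noteq> 0"
  shows "deh (s_vector (extension W \<delta> \<sigma>) U V) = s_vector \<sigma> (deh U) (deh V)"
  unfolding s_vector_def Let_def deh_diff deh_single_scale deh_pp_diff deh_pp_lcm
    lead_term_deh(2,3)[OF \<sigma> U] lead_term_deh(2,3)[OF \<sigma> V] deh_term_def fst_conv
  by (rule refl)

section \<open>The invariant of the algorithm\<close>

lemma pp_lcm_commute: "pp_lcm s t = pp_lcm t s"
  by (simp add: pp_lcm_def max.commute)

lemma s_vector_swap: "s_vector \<sigma> v u = - s_vector \<sigma> u v"
  by (simp add: s_vector_def Let_def pp_lcm_commute)

lemma s_vector_self: "s_vector \<sigma> u u = 0"
  by (simp add: s_vector_def)

lemma lcm_term_commute:
  assumes "snd (lead_term \<sigma> u) = snd (lead_term \<sigma> v)"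
  shows "lcm_term \<sigma> v u = lcm_term \<sigma> u v"
  using assms by (simp add: lcm_term_def pp_lcm_commute)

text \<open>
  Both multiples in the S-vector have the lcm as leading term, with coefficient 1, and it cancels.
\<close>

lemma mterms_s_vector_below_lcm:
  fixes u v :: "('v::finite, 'r::finite, 'k::field) fvec"
  assumes \<sigma>: "module_ordering \<sigma>" and nz: "u \<noteq> 0" "v \<noteq> 0"
    and comp: "snd (lead_term \<sigma> u) = snd (lead_term \<sigma> v)"
    and T: "T \<in> mterms (s_vector \<sigma> u v)"
  shows "(T, lcm_term \<sigma> u v) \<in> \<sigma>"
proof -
  let ?u = "lead_term \<sigma> u" and ?v = "lead_term \<sigma> v"
  define l where "l = pp_lcm (fst ?u) (fst ?v)"
  define L where "L = lcm_term \<sigma> u v"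
  have L: "term_times (l - fst ?u) ?u = L" "term_times (l - fst ?v) ?v = L"
    using comp by (simp_all add: L_def term_times_def lcm_term_def l_def pp_lcm_minus_add)
  have S: "s_vector \<sigma> u v = Poly_Mapping.single (l - fst ?u) (1 / lead_coeff \<sigma> u) *s u
      - Poly_Mapping.single (l - fst ?v) (1 / lead_coeff \<sigma> v) *s v"
    by (simp add: s_vector_def Let_def l_def)
  have "mcoeff (s_vector \<sigma> u v) L = 0"
    using mcoeff_single_scale[of "l - fst ?u" "1 / lead_coeff \<sigma> u" u ?u]
      mcoeff_single_scale[of "l - fst ?v" "1 / lead_coeff \<sigma> v" v ?v]
      lead_coeff_nonzero[OF \<sigma> nz(1)] lead_coeff_nonzero[OF \<sigma> nz(2)]
    unfolding S L by (simp add: lead_coeff_def)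
  then have "T \<noteq> L" using T by (auto simp: mem_mterms)
  have *: "(T, L) \<in> \<sigma>"
    if w: "w \<noteq> 0" "term_times s (lead_term \<sigma> w) = L"
      and Tw: "T \<in> mterms (Poly_Mapping.single s c *s w)"
    for w :: "('v, 'r, 'k) fvec" and s c
  proof -
    obtain x where x: "x \<in> mterms w" "T = term_times s x" using Tw mterms_single_scale by blast
    with \<open>T \<noteq> L\<close> w(2) have "x \<noteq> lead_term \<sigma> w" by blast
    from module_orderingD(4)[OF \<sigma> lead_term_greatest(2)[OF \<sigma> w(1) x(1) this]]
    have "(term_times s x, term_times s (lead_term \<sigma> w)) \<in> \<sigma>" .
    then show ?thesis unfolding x(2) w(2) .
  qed
  from T mterms_diff show ?thesis
    unfolding S L_def[symmetric] using *[OF nz(1) L(1)] *[OF nz(2) L(2)] by blast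
qed

text \<open>
  After dehomogenization a reduction step subtracts a multiple whose leading term is a term of the
  current vector, and a saturation step changes nothing. So the terms of the current vector and
  the leading terms of the subtracted multiples all stay in a set \<open>A\<close> that contains, with each
  term, all smaller ones.
\<close>

lemma weak_sat_steps_deh:
  fixes Q :: "('m::{finite, linorder} + 'n::finite, 'r::finite, 'k::field) fvec"
  assumes \<sigma>: "module_ordering \<sigma>"
    and G: "\<And>V. V \<in> G \<Longrightarrow> homogeneous W \<delta> V" "0 \<notin> G"
    and down: "\<And>u t. (u, t) \<in> \<sigma> \<Longrightarrow> t \<in> A \<Longrightarrow> u \<in> A"
    and steps: "(weak_sat_step W \<delta> (extension W \<delta> \<sigma>) G)\<^sup>*\<^sup>* Q V"
    and Q: "homogeneous W \<delta> Q" "mterms (deh Q) \<subseteq> A"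
  shows "homogeneous W \<delta> V \<and> mterms (deh V) \<subseteq> A \<and> deh Q - deh V \<in> std_span \<sigma> (deh ` G) A"
  using steps
proof (induction rule: rtranclp_induct)
  case base
  then show ?case using Q by (simp add: std_span.zero)
next
  case (step P P')
  from step.hyps(2) consider "red_step (extension W \<delta> \<sigma>) G P P'"
    | "homogeneous W \<delta> P'" "saturation W \<delta> P' = saturation W \<delta> P"
    by (auto simp: weak_sat_step_def)
  then show ?case
  proof cases
    case 1
    then obtain U t c where U: "U \<in> G"
      and t: "term_times t (lead_term (extension W \<delta> \<sigma>) U) \<in> mterms P"
      and P': "P' = P - Poly_Mapping.single t c *s U"
      unfolding red_step_def by blast
    have "U \<noteq> 0" using U G(2) by metis
    note lead = lead_term_deh[OF \<sigma> G(1)[OF U] this]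
    define T where "T = term_times (deh_pp t) (lead_term \<sigma> (deh U))"
    have "T = deh_term (term_times t (lead_term (extension W \<delta> \<sigma>) U))"
      by (simp add: T_def lead(2) deh_term_term_times)
    then have "T \<in> mterms (deh P)" using t mterms_deh[of W \<delta> P] step.IH by simp
    then have "T \<in> A" using step.IH by blast
    have deh_P': "deh P' = deh P - Poly_Mapping.single (deh_pp t) c *s deh U"
      by (simp add: P' deh_diff deh_single_scale)
    have "homogeneous W \<delta> P'"
      unfolding P'
    proof (rule homogeneous_diff)
      show "term_deg (Wbar W) \<delta> u
          = term_deg (Wbar W) \<delta> (term_times t (lead_term (extension W \<delta> \<sigma>) U))"
        if "u \<in> mterms P" for u using homogeneousD[of W \<delta> P] step.IH that t by blast
      show "term_deg (Wbar W) \<delta> u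
          = term_deg (Wbar W) \<delta> (term_times t (lead_term (extension W \<delta> \<sigma>) U))"
        if "u \<in> mterms (Poly_Mapping.single t c *s U)" for u
        by (rule term_deg_single_scale[OF G(1)[OF U] lead(1) that])
    qed
    moreover have "mterms (deh P') \<subseteq> A"
    proof
      fix u
      assume "u \<in> mterms (deh P')"
      then consider "u \<in> mterms (deh P)" | "u \<in> mterms (Poly_Mapping.single (deh_pp t) c *s deh U)"
        unfolding deh_P' using mterms_diff by blast
      then show "u \<in> A"
      proof cases
        case 1
        then show ?thesis using step.IH by blast
      next
        case 2
        then obtain x where x: "x \<in> mterms (deh U)" "u = term_times (deh_pp t) x"
          using mterms_single_scale by blast
        have "deh U \<noteq> 0" using deh_eq_zero_iff[OF G(1)[OF U]] \<open>U \<noteq> 0\<close> by simp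
        then have "u = T \<or> (u, T) \<in> \<sigma>"
          using lead_term_greatest(2)[OF \<sigma> _ x(1)] module_orderingD(4)[OF \<sigma>] x(2)
          unfolding T_def by metis
        then show ?thesis using down[of u T] \<open>T \<in> A\<close> by metis
      qed
    qed
    moreover have "deh Q - deh P' \<in> std_span \<sigma> (deh ` G) A"
    proof -
      have "deh Q - deh P' = (deh Q - deh P) + Poly_Mapping.single (deh_pp t) c *s deh U"
        by (simp add: deh_P')
      moreover have "Poly_Mapping.single (deh_pp t) c *s deh U \<in> std_span \<sigma> (deh ` G) A"
        using \<open>T \<in> A\<close> U by (intro std_span_base) (simp_all add: T_def)
      ultimately show ?thesis using step.IH by (metis std_span_add)
    qed
    ultimately show ?thesis by blast
  next
    case 2
    then have "deh P' = deh P" unfolding saturation_def by (metis deh_hom)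
    then show ?thesis using step.IH 2(1) by simp
  qed
qed

text \<open>
  The remainder itself, if it is not zero, is appended to the computed vectors and then serves as
  the last summand.
\<close>

lemma std_span_of_remainder:
  fixes Q :: "('m::{finite, linorder} + 'n::finite, 'r::finite, 'k::field) fvec"
  assumes \<sigma>: "module_ordering \<sigma>"
    and G: "\<And>V. V \<in> G \<Longrightarrow> homogeneous W \<delta> V" "0 \<notin> G"
    and down: "\<And>u t. (u, t) \<in> \<sigma> \<Longrightarrow> t \<in> A \<Longrightarrow> u \<in> A"
    and rem: "weak_sat_remainder W \<delta> (extension W \<delta> \<sigma>) G Q V"
    and Q: "homogeneous W \<delta> Q" "mterms (deh Q) \<subseteq> A"
  shows "deh Q \<in> std_span \<sigma> (deh ` (G \<union> ({V} - {0}))) A"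
proof -
  have steps: "(weak_sat_step W \<delta> (extension W \<delta> \<sigma>) G)\<^sup>*\<^sup>* Q V"
    using rem by (simp add: weak_sat_remainder_def)
  have "homogeneous W \<delta> V \<and> mterms (deh V) \<subseteq> A \<and> deh Q - deh V \<in> std_span \<sigma> (deh ` G) A"
    by (rule weak_sat_steps_deh[OF \<sigma> G _ steps Q]) (assumption, rule down)
  then have V: "homogeneous W \<delta> V" "mterms (deh V) \<subseteq> A" "deh Q - deh V \<in> std_span \<sigma> (deh ` G) A"
    by simp_all
  have "deh V \<in> std_span \<sigma> (deh ` (G \<union> ({V} - {0}))) A"
  proof (cases "V = 0")
    case True
    then show ?thesis by (simp add: std_span.zero)
  next
    case False
    then have "lead_term \<sigma> (deh V) \<in> A"
      using lead_term_greatest(1)[OF \<sigma>, of "deh V"] deh_eq_zero_iff[OF V(1)] V(2) by blast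
    then have "Poly_Mapping.single 0 1 *s deh V \<in> std_span \<sigma> (deh ` (G \<union> ({V} - {0}))) A"
      using False by (intro std_span_base) (simp_all add: term_times_def)
    then show ?thesis by simp
  qed
  moreover have "deh Q - deh V \<in> std_span \<sigma> (deh ` (G \<union> ({V} - {0}))) A"
    using V(3) by (rule std_span_mono) auto
  ultimately have "deh V + (deh Q - deh V) \<in> std_span \<sigma> (deh ` (G \<union> ({V} - {0}))) A"
    by (rule std_span_add)
  then show ?thesis by simp
qed

text \<open>
  The condition that \<open>buchberger_criterion\<close> puts on the S-vector of the two dehomogenizations.
\<close>

definition s_reduces ::
  "('n::finite, 'r) mterm rel \<Rightarrow> ('m + 'n, 'r::finite, 'k::field) fvec set \<Rightarrow>
   ('m + 'n, 'r, 'k) fvec \<Rightarrow> ('m + 'n, 'r, 'k) fvec \<Rightarrow> bool"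
  where "s_reduces \<sigma> G U V \<longleftrightarrow> s_vector \<sigma> (deh U) (deh V)
    \<in> std_span \<sigma> (deh ` G) {T. (T, lcm_term \<sigma> (deh U) (deh V)) \<in> \<sigma>}"

lemma s_reduces_mono: "s_reduces \<sigma> G U V \<Longrightarrow> G \<subseteq> H \<Longrightarrow> s_reduces \<sigma> H U V"
  unfolding s_reduces_def by (erule std_span_mono) auto

lemma s_reduces_commute:
  assumes "s_reduces \<sigma> G U V" "snd (lead_term \<sigma> (deh U)) = snd (lead_term \<sigma> (deh V))"
  shows "s_reduces \<sigma> G V U"
  using std_span_uminus[OF assms(1)[unfolded s_reduces_def]]
  unfolding s_reduces_def s_vector_swap[of \<sigma> "deh V" "deh U"] lcm_term_commute[OF assms(2)] .

text \<open>
  The set \<open>H\<close> may be larger than \<open>G\<close>: while a step is being carried out, the pairs among the old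
  vectors are settled by means of the old vectors together with the new remainder.
\<close>

definition pairs_settled ::
  "('n::finite, 'r) mterm rel \<Rightarrow> (('m + 'n, 'r::finite, 'k::field) fvec \<times> ('m + 'n, 'r, 'k) fvec) set \<Rightarrow>
   ('m + 'n, 'r, 'k) fvec set \<Rightarrow> ('m + 'n, 'r, 'k) fvec set \<Rightarrow> bool"
  where "pairs_settled \<sigma> pairs G H \<longleftrightarrow> (\<forall>U\<in>G. \<forall>V\<in>G.
    snd (lead_term \<sigma> (deh U)) = snd (lead_term \<sigma> (deh V)) \<longrightarrow>
    (U, V) \<in> pairs \<or> (V, U) \<in> pairs \<or> s_reduces \<sigma> H U V)"

text \<open>
  The set \<open>B\<close> is the given generating set of the module. A pair is recorded in one of its two
  orders only; since \<open>s_vector \<sigma> V U = - s_vector \<sigma> U V\<close>, settling it settles both.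
\<close>

definition bb_invariant ::
  "int ^ 'n ^ 'm::{finite, linorder} \<Rightarrow> ('r \<Rightarrow> int ^ 'm::{finite, linorder}) \<Rightarrow>
   ('n::finite, 'r) mterm rel \<Rightarrow> ('n, 'r::finite, 'k::field) fvec set \<Rightarrow> ('m + 'n, 'r, 'k) bb_state \<Rightarrow> bool"
  where "bb_invariant W \<delta> \<sigma> B = (\<lambda>(gens, pairs, G).
    (\<forall>Q\<in>set_mset gens \<union> set G. homogeneous W \<delta> Q \<and> deh Q \<in> module.span (*s) B) \<and>
    0 \<notin> set G \<and>
    (\<forall>(U, V)\<in>pairs. U \<in> set G \<and> V \<in> set G \<and> snd (lead_term \<sigma> (deh U)) = snd (lead_term \<sigma> (deh V))) \<and>
    B \<subseteq> module.span (*s) (deh ` (set_mset gens \<union> set G)) \<and>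
    pairs_settled \<sigma> pairs (set G) (set G))"

text \<open>
  Adding \<open>V\<close> puts its pairs with the old vectors on the agenda. The pair of \<open>V\<close> with itself
  need not be among them, but its S-vector is 0.
\<close>

lemma bb_invariant_add:
  fixes W :: "int ^ 'n::finite ^ 'm::{finite, linorder}"
    and B :: "('n, 'r::finite, 'k::field) fvec set"
    and V :: "('m + 'n, 'r, 'k) fvec"
  defines "G' G \<equiv> set G \<union> ({V} - {0})"
  assumes \<sigma>: "module_ordering \<sigma>"
    and hom: "\<And>Q. Q \<in> set_mset gens \<union> set G \<Longrightarrow> homogeneous W \<delta> Q \<and> deh Q \<in> module.span (*s) B"
    and V: "homogeneous W \<delta> V" "deh V \<in> module.span (*s) B"
    and nz: "0 \<notin> set G"
    and pairs: "\<And>X Y. (X, Y) \<in> pairs \<Longrightarrow>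
      X \<in> set G \<and> Y \<in> set G \<and> snd (lead_term \<sigma> (deh X)) = snd (lead_term \<sigma> (deh Y))"
    and gen: "B \<subseteq> module.span (*s) (deh ` (set_mset gens \<union> G' G))"
    and settled: "pairs_settled \<sigma> pairs (set G) (G' G)"
  shows "bb_invariant W \<delta> \<sigma> B (bb_add (extension W \<delta> \<sigma>) V (gens, pairs, G))"
proof (cases "V = 0")
  case True
  then show ?thesis
    using hom nz pairs gen settled by (auto simp: bb_add_def bb_invariant_def G'_def)
next
  case False
  have comp: "snd (lead_term (extension W \<delta> \<sigma>) U) = snd (lead_term \<sigma> (deh U))"
    if "U \<in> set (G @ [V])" for U
  proof -
    have "homogeneous W \<delta> U" "U \<noteq> 0" using that hom V(1) nz False by auto
    from lead_term_deh(2)[OF \<sigma> this] show ?thesis by (simp add: deh_term_def)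
  qed
  define new where "new = {(U, V) |U. U \<in> set G \<and>
    snd (lead_term (extension W \<delta> \<sigma>) U) = snd (lead_term (extension W \<delta> \<sigma>) V)}"
  have G': "G' G = set (G @ [V])" using False by (auto simp: G'_def)
  have "pairs_settled \<sigma> (pairs \<union> new) (set (G @ [V])) (set (G @ [V]))"
    unfolding pairs_settled_def
  proof (intro ballI impI)
    fix X Y
    assume XY: "X \<in> set (G @ [V])" "Y \<in> set (G @ [V])"
      and c: "snd (lead_term \<sigma> (deh X)) = snd (lead_term \<sigma> (deh Y))"
    consider "X \<in> set G" "Y \<in> set G" | "X \<in> set G" "Y = V" | "X = V" "Y \<in> set G" | "X = V" "Y = V"
      using XY by auto
    then show "(X, Y) \<in> pairs \<union> new \<or> (Y, X) \<in> pairs \<union> new \<or> s_reduces \<sigma> (set (G @ [V])) X Y"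
    proof cases
      case 1
      then show ?thesis using settled c unfolding pairs_settled_def G' by blast
    next
      case 2
      then have "(X, Y) \<in> new" using c comp XY unfolding new_def by simp
      then show ?thesis by simp
    next
      case 3
      then have "(Y, X) \<in> new" using c comp XY unfolding new_def by simp
      then show ?thesis by simp
    next
      case 4
      then show ?thesis by (simp add: s_reduces_def s_vector_self std_span.zero)
    qed
  qed
  moreover have "X \<in> set (G @ [V]) \<and> Y \<in> set (G @ [V]) \<and>
      snd (lead_term \<sigma> (deh X)) = snd (lead_term \<sigma> (deh Y))" if "(X, Y) \<in> pairs \<union> new" for X Y
  proof (cases "(X, Y) \<in> pairs")
    case True
    then show ?thesis using pairs by simp
  next
    case False
    then show ?thesis using that comp by (auto simp: new_def)
  qed
  ultimately show ?thesis
    using hom nz V False gen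
    by (auto simp: bb_add_def bb_invariant_def G' simp flip: new_def)
qed

lemma remainder_in_span:
  fixes Q :: "('m::{finite, linorder} + 'n::finite, 'r::finite, 'k::field) fvec"
  assumes \<sigma>: "module_ordering \<sigma>"
    and G: "\<And>V. V \<in> G \<Longrightarrow> homogeneous W \<delta> V \<and> deh V \<in> module.span (*s) B" "0 \<notin> G"
    and rem: "weak_sat_remainder W \<delta> (extension W \<delta> \<sigma>) G Q V"
    and Q: "homogeneous W \<delta> Q" "deh Q \<in> module.span (*s) B"
  shows "homogeneous W \<delta> V" and "deh V \<in> module.span (*s) B"
proof -
  have V: "homogeneous W \<delta> V" "deh Q - deh V \<in> std_span \<sigma> (deh ` G) UNIV"
    using weak_sat_steps_deh[OF \<sigma> _ G(2) _ _ Q(1), of UNIV V] G(1) rem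
    unfolding weak_sat_remainder_def by blast+
  show "homogeneous W \<delta> V" by (rule V(1))
  have "deh Q - deh V \<in> module.span (*s) (deh ` G)"
    using V(2) std_span_subset_span by blast
  moreover have "module.span (*s) (deh ` G) \<subseteq> module.span (*s) B"
    using G(1) by (intro module.span_minimal[OF module_vec] module.subspace_span[OF module_vec]) auto
  ultimately have "deh Q - deh V \<in> module.span (*s) B" by blast
  from module.span_diff[OF module_vec Q(2) this] show "deh V \<in> module.span (*s) B" by simp
qed

text \<open>
  A processed generator stays in the span of the computed vectors together with its remainder, and
  a processed pair becomes settled by the vectors used in the division and the remainder.
\<close>

lemma bb_invariant_step:
  fixes W :: "int ^ 'n::finite ^ 'm::{finite, linorder}"
    and B :: "('n, 'r::finite, 'k::field) fvec set"
  assumes \<sigma>: "module_ordering \<sigma>"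
    and step: "bb_step (extension W \<delta> \<sigma>) (weak_sat_remainder W \<delta> (extension W \<delta> \<sigma>)) st st'"
    and inv: "bb_invariant W \<delta> \<sigma> B st"
  shows "bb_invariant W \<delta> \<sigma> B st'"
  using step
proof cases
  case (gen Q gens G V pairs)
  have hom: "\<And>P. P \<in> set_mset gens \<union> set G \<Longrightarrow> homogeneous W \<delta> P \<and> deh P \<in> module.span (*s) B"
    and nz: "0 \<notin> set G"
    and pairs: "\<And>X Y. (X, Y) \<in> pairs \<Longrightarrow>
      X \<in> set G \<and> Y \<in> set G \<and> snd (lead_term \<sigma> (deh X)) = snd (lead_term \<sigma> (deh Y))"
    and B: "B \<subseteq> module.span (*s) (deh ` (set_mset gens \<union> set G))"
    and settled: "pairs_settled \<sigma> pairs (set G) (set G)"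
    using inv unfolding gen(1) bb_invariant_def by auto
  define G' where "G' = set G \<union> ({V} - {0})"
  have Q: "homogeneous W \<delta> Q" "deh Q \<in> module.span (*s) B" using hom gen(3) by auto
  have V: "homogeneous W \<delta> V" "deh V \<in> module.span (*s) B"
    by (rule remainder_in_span[OF \<sigma> _ nz gen(4) Q], use hom in simp)+
  have "deh Q \<in> std_span \<sigma> (deh ` G') UNIV"
    unfolding G'_def by (rule std_span_of_remainder[OF \<sigma> _ nz _ gen(4) Q(1)]) (use hom in simp_all)
  then have dehQ: "deh Q \<in> module.span (*s) (deh ` G')" using std_span_subset_span by blast
  have "deh P \<in> module.span (*s) (deh ` (set_mset (gens - {#Q#}) \<union> G'))"
    if P: "P \<in> set_mset gens \<union> set G" for P
  proof (cases "P = Q")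
    case True
    then show ?thesis
      using dehQ module.span_mono[OF module_vec, of "deh ` G'" "deh ` (set_mset (gens - {#Q#}) \<union> G')"]
      by blast
  next
    case False
    then have "P \<in> set_mset (gens - {#Q#}) \<union> G'"
      using P by (auto simp: G'_def in_diff_count not_in_iff)
    then show ?thesis by (intro module.span_base[OF module_vec] imageI)
  qed
  then have "module.span (*s) (deh ` (set_mset gens \<union> set G))
      \<subseteq> module.span (*s) (deh ` (set_mset (gens - {#Q#}) \<union> G'))"
    by (intro module.span_minimal[OF module_vec] module.subspace_span[OF module_vec]) blast
  with B have B': "B \<subseteq> module.span (*s) (deh ` (set_mset (gens - {#Q#}) \<union> G'))" by blast
  show ?thesis
    unfolding gen(2)
  proof (rule bb_invariant_add[OF \<sigma> _ V nz pairs B'[unfolded G'_def]])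
    show "homogeneous W \<delta> P \<and> deh P \<in> module.span (*s) B"
      if "P \<in> set_mset (gens - {#Q#}) \<union> set G" for P
      using that hom[of P] by (auto dest: in_diffD)
    show "pairs_settled \<sigma> pairs (set G) (set G \<union> ({V} - {0}))"
      using settled s_reduces_mono[of \<sigma> "set G" _ _ "set G \<union> ({V} - {0})"]
      unfolding pairs_settled_def by blast
  qed
next
  case (pair U U' pairs G V gens)
  have hom: "\<And>P. P \<in> set_mset gens \<union> set G \<Longrightarrow> homogeneous W \<delta> P \<and> deh P \<in> module.span (*s) B"
    and nz: "0 \<notin> set G"
    and pairs: "\<And>X Y. (X, Y) \<in> pairs \<Longrightarrow>
      X \<in> set G \<and> Y \<in> set G \<and> snd (lead_term \<sigma> (deh X)) = snd (lead_term \<sigma> (deh Y))"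
    and B: "B \<subseteq> module.span (*s) (deh ` (set_mset gens \<union> set G))"
    and settled: "pairs_settled \<sigma> pairs (set G) (set G)"
    using inv unfolding pair(1) bb_invariant_def by auto
  define G' where "G' = set G \<union> ({V} - {0})"
  have UU': "U \<in> set G" "U' \<in> set G" "snd (lead_term \<sigma> (deh U)) = snd (lead_term \<sigma> (deh U'))"
    using pairs[OF pair(3)] by auto
  have U: "homogeneous W \<delta> U" "U \<noteq> 0" "homogeneous W \<delta> U'" "U' \<noteq> 0"
    using UU' hom nz by auto
  let ?S = "s_vector (extension W \<delta> \<sigma>) U U'"
  have hS: "homogeneous W \<delta> ?S"
    using lead_term_deh(2)[OF \<sigma> U(1,2)] lead_term_deh(2)[OF \<sigma> U(3,4)] UU'(3)
    by (intro homogeneous_s_vector[OF \<sigma> U]) (simp add: deh_term_def)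
  have dS: "deh ?S = s_vector \<sigma> (deh U) (deh U')" by (rule deh_s_vector[OF \<sigma> U])
  have "s_vector \<sigma> (deh U) (deh U') \<in> module.span (*s) B"
    unfolding s_vector_def Let_def using hom UU'(1,2)
    by (intro module.span_diff[OF module_vec] module.span_scale[OF module_vec]) auto
  then have S: "deh ?S \<in> module.span (*s) B" by (simp add: dS)
  have V: "homogeneous W \<delta> V" "deh V \<in> module.span (*s) B"
    by (rule remainder_in_span[OF \<sigma> _ nz pair(4) hS S], use hom in simp)+
  have "mterms (deh ?S) \<subseteq> {T. (T, lcm_term \<sigma> (deh U) (deh U')) \<in> \<sigma>}"
    unfolding dS using mterms_s_vector_below_lcm[OF \<sigma> _ _ UU'(3)] deh_eq_zero_iff[OF U(1)]
      deh_eq_zero_iff[OF U(3)] U(2,4) by blast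
  from std_span_of_remainder[OF \<sigma> _ nz _ pair(4) hS this]
  have red: "s_reduces \<sigma> G' U U'"
    unfolding s_reduces_def G'_def dS using hom module_orderingD(2)[OF \<sigma>] by blast
  have settled': "pairs_settled \<sigma> (pairs - {(U, U')}) (set G) G'"
    unfolding pairs_settled_def
  proof (intro ballI impI)
    fix X Y
    assume XY: "X \<in> set G" "Y \<in> set G" "snd (lead_term \<sigma> (deh X)) = snd (lead_term \<sigma> (deh Y))"
    have "s_reduces \<sigma> G' X Y" if "(X, Y) = (U, U') \<or> (Y, X) = (U, U')"
      using that red s_reduces_commute[OF red UU'(3)] by blast
    moreover have "s_reduces \<sigma> G' X Y" if "s_reduces \<sigma> (set G) X Y"
      using that by (rule s_reduces_mono) (simp add: G'_def)
    ultimately show "(X, Y) \<in> pairs - {(U, U')} \<or> (Y, X) \<in> pairs - {(U, U')} \<or> s_reduces \<sigma> G' X Y"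
      using settled XY unfolding pairs_settled_def by blast
  qed
  have "B \<subseteq> module.span (*s) (deh ` (set_mset gens \<union> G'))"
    using B module.span_mono[OF module_vec, of "deh ` (set_mset gens \<union> set G)"
        "deh ` (set_mset gens \<union> G')"]
    unfolding G'_def by blast
  from bb_invariant_add[OF \<sigma> hom V nz _ this[unfolded G'_def] settled'[unfolded G'_def]]
  show ?thesis unfolding pair(2) using pairs by blast
qed

lemma bb_invariant_steps:
  fixes W :: "int ^ 'n::finite ^ 'm::{finite, linorder}"
    and B :: "('n, 'r::finite, 'k::field) fvec set"
  assumes \<sigma>: "module_ordering \<sigma>"
    and "(bb_step (extension W \<delta> \<sigma>) (weak_sat_remainder W \<delta> (extension W \<delta> \<sigma>)))\<^sup>*\<^sup>* st st'"
    and "bb_invariant W \<delta> \<sigma> B st"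
  shows "bb_invariant W \<delta> \<sigma> B st'"
  using assms(2,3) by (induction rule: rtranclp_induct) (auto intro: bb_invariant_step[OF \<sigma>])

theorem theorem21:
  fixes W :: "int ^ 'n::finite ^ 'm::{finite, linorder}"
    and \<delta> :: "'r::finite \<Rightarrow> int ^ 'm::{finite, linorder}"
    and \<sigma> :: "('n, 'r) mterm rel"
    and vs :: "('n, 'r, 'k::field) fvec list"
    and Vs :: "('m + 'n, 'r, 'k) fvec list"
  assumes "rank (map_matrix rat_of_int W) = CARD('m)"
    and "module_ordering \<sigma>"
    and "0 \<notin> set vs"
    and "weak_self_sat_buchberger_output W \<delta> \<sigma> (map (hom W \<delta>) vs) Vs"
  shows "groebner_basis \<sigma> (module.span (*s) (set vs)) (deh ` set Vs)"
proof -
  note \<sigma> = \<open>module_ordering \<sigma>\<close>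
  let ?M = "module.span (*s) (set vs)"
  let ?G = "deh ` set Vs"
  have "bb_invariant W \<delta> \<sigma> (set vs) (mset (map (hom W \<delta>) vs), {}, [])"
    unfolding bb_invariant_def pairs_settled_def
    by (auto simp: homogeneous_hom deh_hom image_image
        intro: module.span_base[OF module_vec])
  moreover have "(bb_step (extension W \<delta> \<sigma>) (weak_sat_remainder W \<delta> (extension W \<delta> \<sigma>)))\<^sup>*\<^sup>*
      (mset (map (hom W \<delta>) vs), {}, []) ({#}, {}, Vs)"
    using assms(4) unfolding weak_self_sat_buchberger_output_def buchberger_output_def .
  ultimately have "bb_invariant W \<delta> \<sigma> (set vs) ({#}, {}, Vs)"
    by (rule bb_invariant_steps[OF \<sigma>, rotated])
  then have Vs: "\<And>V. V \<in> set Vs \<Longrightarrow> homogeneous W \<delta> V \<and> deh V \<in> ?M" "0 \<notin> set Vs"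
    and gen: "set vs \<subseteq> module.span (*s) ?G"
    and settled: "pairs_settled \<sigma> {} (set Vs) (set Vs)"
    unfolding bb_invariant_def by auto
  have nz: "0 \<notin> ?G" using deh_eq_zero_iff Vs by fastforce
  have sub: "?G \<subseteq> ?M - {0}" using Vs(1) nz by auto
  have "?M \<subseteq> module.span (*s) ?G"
    by (intro module.span_minimal[OF module_vec gen] module.subspace_span[OF module_vec])
  have divides: "\<exists>g\<in>?G. \<exists>s. lead_term \<sigma> f = term_times s (lead_term \<sigma> g)" if f: "f \<in> ?M - {0}" for f
  proof (rule buchberger_criterion[OF \<sigma> _ nz])
    show "s_vector \<sigma> g h \<in> std_span \<sigma> ?G {T. (T, lcm_term \<sigma> g h) \<in> \<sigma>}"
      if "g \<in> ?G" "h \<in> ?G" "snd (lead_term \<sigma> g) = snd (lead_term \<sigma> h)" for g h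
      using settled that unfolding pairs_settled_def s_reduces_def by blast
    show "f \<in> module.span (*s) ?G" "f \<noteq> 0" using f \<open>?M \<subseteq> module.span (*s) ?G\<close> by auto
  qed simp
  let ?lt = "\<lambda>v. term_vec (lead_term \<sigma> v) :: ('n, 'r, 'k) fvec"
  have "?lt f \<in> module.span (*s) (?lt ` ?G)" if f: "f \<in> ?M - {0}" for f
  proof -
    obtain g s where g: "g \<in> ?G" "lead_term \<sigma> f = term_times s (lead_term \<sigma> g)"
      using divides[OF f] by blast
    have "?lt f = Poly_Mapping.single s 1 *s ?lt g"
      unfolding g(2) by (simp add: term_vec_def term_times_def axis_def vec_eq_iff mult_single)
    then show ?thesis
      using g(1) by (metis module.span_scale[OF module_vec] module.span_base[OF module_vec] imageI)
  qed
  then have "module.span (*s) (?lt ` (?M - {0})) \<subseteq> module.span (*s) (?lt ` ?G)"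
    by (intro module.span_minimal[OF module_vec] module.subspace_span[OF module_vec]) blast
  moreover have "module.span (*s) (?lt ` ?G) \<subseteq> module.span (*s) (?lt ` (?M - {0}))"
    using sub by (intro module.span_mono[OF module_vec] image_mono)
  ultimately show ?thesis unfolding groebner_basis_def using sub by blast
qed

end
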